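(* Let $\pi=N(0,\Sigma)$ be a Gaussian distribution on $\mathbb{R}^d$ with positive definite covariance, with coordinates partitioned into $s$ blocks, and let $P_p=\sum_{i=1}^s p_iPr_i$ be the Random Scan Gibbs Sampler kernel for a probability vector $p$ with all $p_i>0$. Then the eigenfunction of $P_p$ in $L_2(\mathbb{R}^d,\pi)$ corresponding to the second largest eigenvalue of $P_p$ is a linear function of $x$.
   Context: $Pr_i$ is the Markov kernel that replaces the block $x_i$ of $x=(x_1,\dots,x_s)$ by a draw from the conditional distribution $\pi(x_i\mid x_{-i})$, regarded as an operator on $L_2(\mathbb{R}^d,\pi)$ via $(Pr_if)(x)=\int f(y_i,x_{-i})\pi(dy_i\mid x_{-i})$. *)

theory Defs
  imports "HOL-Probability.Probability"
begin

definition pos_def_matrix :: "real^'d^'d \<Rightarrow> bool" where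
  "pos_def_matrix S \<longleftrightarrow> transpose S = S \<and> (\<forall>x. x \<noteq> 0 \<longrightarrow> x \<bullet> (S *v x) > 0)"

definition gauss_density :: "real^'d^'d \<Rightarrow> real^'d \<Rightarrow> real" where
  "gauss_density S x =
     exp (- (x \<bullet> (matrix_inv S *v x)) / 2) / sqrt ((2 * pi) ^ CARD('d) * det S)"

definition gaussian :: "real^'d^'d \<Rightarrow> (real^'d) measure" where
  "gaussian S = density lborel (\<lambda>x. ennreal (gauss_density S x))"

text \<open>Coordinates are partitioned into blocks via blk: coordinate j lies in block blk j.
  drop_block blk i x keeps x_{-i} (the coordinates outside block i).\<close>
definition drop_block :: "('d \<Rightarrow> nat) \<Rightarrow> nat \<Rightarrow> real^'d \<Rightarrow> real^'d" where
  "drop_block blk i x = (\<chi> j. if blk j = i then 0 else x $ j)"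

definition other_blocks_algebra :: "('d \<Rightarrow> nat) \<Rightarrow> nat \<Rightarrow> (real^'d) measure" where
  "other_blocks_algebra blk i = vimage_algebra UNIV (drop_block blk i) borel"

text \<open>Pr_i f (x) = \<integral> f(y_i, x_{-i}) \<pi>(dy_i | x_{-i}) = E_\<pi>[f | x_{-i}] (x).\<close>
definition block_kernel :: "(real^'d) measure \<Rightarrow> ('d \<Rightarrow> nat) \<Rightarrow> nat \<Rightarrow> (real^'d \<Rightarrow> real) \<Rightarrow> real^'d \<Rightarrow> real" where
  "block_kernel M blk i f = real_cond_exp M (other_blocks_algebra blk i) f"

definition rsgs :: "(real^'d) measure \<Rightarrow> ('d \<Rightarrow> nat) \<Rightarrow> nat \<Rightarrow> (nat \<Rightarrow> real) \<Rightarrow> (real^'d \<Rightarrow> real) \<Rightarrow> real^'d \<Rightarrow> real" where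
  "rsgs M blk s p f = (\<lambda>x. \<Sum>i<s. p i * block_kernel M blk i f x)"

definition L2 :: "'a measure \<Rightarrow> ('a \<Rightarrow> real) set" where
  "L2 M = {f. f \<in> borel_measurable M \<and> integrable M (\<lambda>x. (f x)\<^sup>2)}"

definition is_eigenpair :: "'a measure \<Rightarrow> (('a \<Rightarrow> real) \<Rightarrow> 'a \<Rightarrow> real) \<Rightarrow> real \<Rightarrow> ('a \<Rightarrow> real) \<Rightarrow> bool" where
  "is_eigenpair M T l f \<longleftrightarrow> f \<in> L2 M \<and> \<not> (AE x in M. f x = 0) \<and> (AE x in M. T f x = l * f x)"

text \<open>Second largest eigenvalue: the largest eigenvalue of T on L_2^0(M) (mean-zero functions),
  the top eigenvalue 1 being the one of the constants.\<close>
definition second_eigenvalue :: "'a measure \<Rightarrow> (('a \<Rightarrow> real) \<Rightarrow> 'a \<Rightarrow> real) \<Rightarrow> real" where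
  "second_eigenvalue M T = Sup {l. \<exists>f. is_eigenpair M T l f \<and> integral\<^sup>L M f = 0}"

end

theory Submission
  imports Defs
begin

text \<open>
  Each \<open>Pr\<^sub>i\<close> maps the exponential \<open>e\<^sub>a(x) = exp (a \<bullet> x - a \<bullet> \<Sigma>a / 2)\<close> to \<open>e\<^bsub>\<Pi>\<^sub>i a\<^esub>\<close>, where \<open>\<Pi>\<^sub>i\<close> is the
  \<open>\<Sigma>\<close>-orthogonal projection onto the vectors vanishing on block \<open>i\<close>; likewise it maps \<open>a \<bullet> x\<close> to
  \<open>\<Pi>\<^sub>i a \<bullet> x\<close>. So on linear functions \<open>P\<^sub>p\<close> acts as the self-adjoint \<open>K = \<Sum>\<^sub>i p\<^sub>i \<Pi>\<^sub>i\<close>; let \<open>l \<ge> 0\<close> be the top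
  eigenvalue of \<open>K\<close>. Suppose \<open>f\<close> is a mean-zero eigenfunction with eigenvalue \<open>\<mu> > l\<close>. Its transform
  \<open>F(a) = E[f e\<^sub>a]\<close> satisfies \<open>\<mu> F(a) = \<Sum>\<^sub>i p\<^sub>i F(\<Pi>\<^sub>i a)\<close> and vanishes at \<open>0\<close>. The linear part of \<open>F\<close> at \<open>0\<close> is
  then an eigenvector of \<open>K\<close> for \<open>\<mu>\<close>, hence zero, so \<open>|F(a)| \<le> C (a \<bullet> \<Sigma>a)\<close> on bounded sets. Since
  \<open>\<Sum>\<^sub>i p\<^sub>i (\<Pi>\<^sub>i a \<bullet> \<Sigma>\<Pi>\<^sub>i a) = a \<bullet> \<Sigma>Ka \<le> l (a \<bullet> \<Sigma>a)\<close>, iterating the equation multiplies the bound by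
  \<open>(l / \<mu>)\<^sup>n \<rightarrow> 0\<close>. Thus \<open>F = 0\<close>, and \<open>f = 0\<close> by uniqueness of the Laplace transform. No expansion in
  Hermite polynomials is needed.
\<close>

section \<open>Uniqueness of the Laplace transform\<close>

text \<open>The exponential series is integrated term by term, with
  \<open>\<bar>g x\<bar> * exp (norm z * \<bar>Y x\<bar>)\<close> as dominating function. As
  \<open>z\<close> is complex, a single power series covers both the Laplace transform (real
  \<open>z\<close>) and the characteristic function (imaginary \<open>z\<close>).\<close>

lemma sums_integral_mult_exp:
  fixes g Y :: "'a \<Rightarrow> real" and z :: complex
  assumes [measurable]: "g \<in> borel_measurable M" "Y \<in> borel_measurable M"
    and int: "\<And>k. integrable M (\<lambda>x. g x * exp (k * \<bar>Y x\<bar>))"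
  shows "(\<lambda>n. of_real (\<integral>x. g x * Y x ^ n / fact n \<partial>M) * z ^ n) sums
           (\<integral>x. of_real (g x) * exp (z * of_real (Y x)) \<partial>M)"
proof -
  \<comment> \<open>A single term of the exponential series of a nonnegative number lies below the
    whole series.\<close>
  have bd: "\<bar>g x\<bar> * (\<bar>Y x\<bar> ^ n * k ^ n / fact n) \<le> \<bar>g x * exp (k * \<bar>Y x\<bar>)\<bar>" if "0 \<le> k" for n k x
  proof -
    have "(\<Sum>i\<in>{n}. (k * \<bar>Y x\<bar>) ^ i /\<^sub>R fact i) \<le> exp (k * \<bar>Y x\<bar>)"
      using that summable_exp_generic[of "k * \<bar>Y x\<bar>"]
      unfolding exp_def by (intro sum_le_suminf) auto
    then have "\<bar>Y x\<bar> ^ n * k ^ n / fact n \<le> exp (k * \<bar>Y x\<bar>)"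
      by (simp add: power_mult_distrib divide_inverse mult_ac)
    from mult_left_mono[OF this, of "\<bar>g x\<bar>"] show ?thesis by (simp add: abs_mult)
  qed
  have intn: "integrable M (\<lambda>x. g x * Y x ^ n / fact n)" for n
    by (rule Bochner_Integration.integrable_bound[OF int[of 1]])
       (use bd[of 1 _ n] in \<open>auto simp: abs_mult power_abs\<close>)
  define h where "h = (\<lambda>n x. of_real (g x * Y x ^ n / fact n) * z ^ n)"
  have h_eq: "h n x = of_real (g x) * ((z * of_real (Y x)) ^ n /\<^sub>R fact n)" for n x
    by (simp add: h_def power_mult_distrib scaleR_conv_of_real divide_inverse mult.assoc)
  have h_int: "integrable M (h n)" for n
    unfolding h_def using intn[of n] by (intro integrable_mult_left integrable_of_real)
  have h_sums: "(\<lambda>n. h n x) sums (of_real (g x) * exp (z * of_real (Y x)))" for x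
    unfolding h_eq by (intro sums_mult exp_converges)
  have nh: "norm (h n x) = \<bar>g x\<bar> * ((norm z * \<bar>Y x\<bar>) ^ n /\<^sub>R fact n)" for n x
    by (simp add: h_eq norm_mult norm_power)
  have nh_sums: "(\<lambda>n. norm (h n x)) sums (\<bar>g x\<bar> * exp (norm z * \<bar>Y x\<bar>))" for x
    unfolding nh by (intro sums_mult exp_converges)
  have "summable (\<lambda>n. \<integral>x. norm (h n x) \<partial>M)"
  proof (rule bounded_imp_summable)
    show "0 \<le> (\<integral>x. norm (h n x) \<partial>M)" for n by simp
    show "(\<Sum>i\<le>n. \<integral>x. norm (h i x) \<partial>M) \<le> (\<integral>x. \<bar>g x * exp (norm z * \<bar>Y x\<bar>)\<bar> \<partial>M)" for n
    proof -
      have "(\<Sum>i\<le>n. \<integral>x. norm (h i x) \<partial>M) = (\<integral>x. (\<Sum>i\<le>n. norm (h i x)) \<partial>M)"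
        using h_int by (intro Bochner_Integration.integral_sum[symmetric] integrable_norm)
      also have "\<dots> \<le> (\<integral>x. \<bar>g x * exp (norm z * \<bar>Y x\<bar>)\<bar> \<partial>M)"
      proof (rule integral_mono)
        show "(\<Sum>i\<le>n. norm (h i x)) \<le> \<bar>g x * exp (norm z * \<bar>Y x\<bar>)\<bar>" for x
          using nh_sums[of x] sum_le_suminf[of "\<lambda>n. norm (h n x)" "{..n}"]
          by (auto simp: sums_iff abs_mult)
      qed (use h_int int in auto)
      finally show ?thesis .
    qed
  qed
  moreover have "AE x in M. summable (\<lambda>n. norm (h n x))"
    using nh_sums by (auto simp: sums_iff)
  ultimately have "(\<lambda>n. integral\<^sup>L M (h n)) sums (\<integral>x. (\<Sum>n. h n x) \<partial>M)"
    using h_int by (intro sums_integral)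
  moreover have "(\<Sum>n. h n x) = of_real (g x) * exp (z * of_real (Y x))" for x
    using h_sums by (simp add: sums_iff)
  moreover have "integral\<^sup>L M (h n) = of_real (\<integral>x. g x * Y x ^ n / fact n \<partial>M) * z ^ n" for n
    unfolding h_def by (simp only: integral_mult_left_zero integral_complex_of_real)
  ultimately show ?thesis by simp
qed

text \<open>Dividing by the lowest power with a nonzero coefficient leaves a series that vanishes at
  every real \<open>t \<noteq> 0\<close>; by continuity it vanishes at 0 as well, where its value is
  that coefficient.\<close>

lemma powser_eq_0_imp_coeff_eq_0:
  fixes a :: "nat \<Rightarrow> complex"
  assumes "\<And>t::real. (\<lambda>n. a n * of_real t ^ n) sums 0"
  shows "a n = 0"
proof (rule ccontr)
  assume "a n \<noteq> 0"
  define m where "m = (LEAST n. a n \<noteq> 0)"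
  have m: "a m \<noteq> 0" unfolding m_def by (rule LeastI) fact
  have below: "a k = 0" if "k < m" for k using that not_less_Least unfolding m_def by blast
  define b where "b = (\<lambda>n. a (n + m))"
  have bs: "(\<lambda>n. b n * of_real t ^ n) sums 0" if "t \<noteq> 0" for t :: real
  proof -
    have "(\<lambda>n. a (n + m) * of_real t ^ (n + m)) sums 0"
      using assms[of t] below by (subst sums_iff_shift) auto
    then have "(\<lambda>n. a (n + m) * of_real t ^ (n + m) / of_real t ^ m) sums (0 / of_real t ^ m)"
      by (rule sums_divide)
    then show ?thesis using that by (simp add: b_def power_add)
  qed
  have cr: "summable (\<lambda>n. b n * z ^ n)" if "norm z < 1" for z
    using powser_inside[of b "1::complex" z] bs[of 1] that by (auto simp: sums_iff)
  have cont: "isCont (\<lambda>z. \<Sum>n. b n * z ^ n) 0"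
    using cr[of "1/2"] by (intro isCont_powser[of b "1/2"]) auto
  have "(\<lambda>k. \<Sum>n. b n * (of_real (inverse (real (Suc k))) :: complex) ^ n) \<longlonglongrightarrow> (\<Sum>n. b n * 0 ^ n)"
    using isCont_tendsto_compose[OF cont, of _ sequentially]
      tendsto_of_real[OF LIMSEQ_inverse_real_of_nat, where 'a = complex]
    unfolding of_real_0 by blast
  moreover have "(\<Sum>n. b n * (of_real (inverse (real (Suc k))) :: complex) ^ n) = 0" for k
    using bs[of "inverse (real (Suc k))"] by (simp add: sums_iff)
  ultimately have "b 0 = 0" by (simp add: LIMSEQ_const_iff)
  with m show False by (simp add: b_def)
qed

text \<open>All moments of the signed law of \<open>Y\<close> under \<open>g\<close> vanish, hence so does its characteristic function.\<close>
lemma exp_integral_eq_0_imp_fibre_integral_eq_0: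
  fixes g Y :: "'a \<Rightarrow> real"
  assumes [measurable]: "g \<in> borel_measurable M" "Y \<in> borel_measurable M"
    and int: "\<And>k. integrable M (\<lambda>x. g x * exp (k * \<bar>Y x\<bar>))"
    and zero: "\<And>t. (\<integral>x. g x * exp (t * Y x) \<partial>M) = 0"
    and [measurable]: "B \<in> sets borel"
  shows "(\<integral>x. g x * indicator B (Y x) \<partial>M) = 0"
proof -
  have gi: "integrable M g" using int[of 0] by simp
  have mom: "of_real (\<integral>x. g x * Y x ^ n / fact n \<partial>M) = (0::complex)" for n
  proof (rule powser_eq_0_imp_coeff_eq_0)
    fix t :: real
    have "(\<integral>x. complex_of_real (g x) * exp (of_real t * of_real (Y x)) \<partial>M) =
        of_real (\<integral>x. g x * exp (t * Y x) \<partial>M)"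
      unfolding integral_complex_of_real[symmetric]
      by (simp add: exp_of_real flip: of_real_mult)
    then show "(\<lambda>n. of_real (\<integral>x. g x * Y x ^ n / fact n \<partial>M) * complex_of_real t ^ n) sums 0"
      using sums_integral_mult_exp[OF assms(1-3), of "of_real t"] zero by simp
  qed
  \<comment> \<open>The same series, whose coefficients are now known to vanish, evaluated on the
    imaginary axis.\<close>
  have chr: "(\<integral>x. of_real (g x) * iexp (t * Y x) \<partial>M) = 0" for t
  proof -
    have "(\<integral>x. of_real (g x) * exp ((\<i> * of_real t) * of_real (Y x)) \<partial>M) = 0"
      using sums_integral_mult_exp[OF assms(1-3), of "\<i> * of_real t"] mom by (simp add: sums_iff)
    then show ?thesis by (simp add: mult.assoc)
  qed
  \<comment> \<open>The positive and the negative part of \<open>g\<close> have the same mass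
    \<open>m\<close>, because the integral of \<open>g\<close> vanishes (\<open>t = 0\<close>). If
    \<open>m = 0\<close> then \<open>g\<close> is zero almost everywhere; otherwise division by
    \<open>m\<close> turns both parts into probability densities, and Levy's theorem compares the
    two laws of \<open>Y\<close>.\<close>
  define m where "m = (\<integral>x. max 0 (g x) \<partial>M)"
  have gpi: "integrable M (\<lambda>x. max 0 (g x))" and gmi: "integrable M (\<lambda>x. max 0 (- g x))"
    using gi by auto
  have diff: "max 0 (g x) - max 0 (- g x) = g x" for x by auto
  have gm: "(\<integral>x. max 0 (- g x) \<partial>M) = m"
    using Bochner_Integration.integral_diff[OF gpi gmi] zero[of 0] by (simp add: m_def diff)
  have m0: "0 \<le> m" by (simp add: m_def)
  show ?thesis
  proof (cases "m = 0")
    case True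
    have "AE x in M. max 0 (g x) = 0" "AE x in M. max 0 (- g x) = 0"
      using integral_nonneg_eq_0_iff_AE[OF gpi] integral_nonneg_eq_0_iff_AE[OF gmi] True gm
      by (auto simp: m_def)
    then have "AE x in M. g x * indicator B (Y x) = 0" by eventually_elim (auto simp: max_def split: if_splits)
    then show ?thesis by (rule integral_eq_zero_AE)
  next
    case False
    with m0 have mp: "0 < m" by simp
    define D where "D h = density M (\<lambda>x. ennreal (h x / m))" for h
    define N where "N h = distr (D h) borel Y" for h
    have em: "(\<integral>\<^sup>+x. ennreal (h x / m) \<partial>M) = 1"
      if "integrable M h" "\<And>x. 0 \<le> h x" "integral\<^sup>L M h = m" for h
      using that mp by (subst nn_integral_eq_integral) auto
    have D: "prob_space (D h)" if [measurable]: "integrable M h" and "\<And>x. 0 \<le> h x" "integral\<^sup>L M h = m" for h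
    proof
      show "emeasure (D h) (space (D h)) = 1"
        unfolding D_def using em[OF that] mp
        by (simp add: emeasure_density cong: nn_integral_cong)
    qed
    have N: "real_distribution (N h)" if "integrable M h" "\<And>x. 0 \<le> h x" "integral\<^sup>L M h = m" for h
    proof -
      interpret prob_space "D h" by (rule D[OF that])
      show ?thesis unfolding N_def by (intro real_distribution_distr) (simp add: D_def)
    qed
    have Nint: "integral\<^sup>L (N h) u = (\<integral>x. (h x / m) *\<^sub>R u (Y x) \<partial>M)"
      if [measurable]: "h \<in> borel_measurable M" "u \<in> borel_measurable borel" and "\<And>x. 0 \<le> h x"
      for h and u :: "real \<Rightarrow> 'b::{banach, second_countable_topology}"
    proof -
      have "integral\<^sup>L (N h) u = (\<integral>x. u (Y x) \<partial>D h)"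
        unfolding N_def by (rule integral_distr) (auto simp: D_def)
      also have "\<dots> = (\<integral>x. (h x / m) *\<^sub>R u (Y x) \<partial>M)"
        unfolding D_def using that mp by (intro integral_density) auto
      finally show ?thesis .
    qed
    \<comment> \<open>Used twice: with \<open>u\<close> a complex exponential it equates the
      characteristic functions of the two laws, and with \<open>u\<close> an indicator it translates
      equality of the laws back into a statement about \<open>g\<close>.\<close>
    have split_eq: "(\<integral>x. (max 0 (g x) / m) *\<^sub>R u (Y x) \<partial>M) - (\<integral>x. (max 0 (- g x) / m) *\<^sub>R u (Y x) \<partial>M)
        = (\<integral>x. g x *\<^sub>R u (Y x) \<partial>M) /\<^sub>R m"
      if [measurable]: "u \<in> borel_measurable borel" and u: "\<And>y. norm (u y) \<le> 1"
      for u :: "real \<Rightarrow> 'b::{banach, second_countable_topology}"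
    proof -
      have i: "integrable M (\<lambda>x. (h x / m) *\<^sub>R u (Y x))" if [measurable]: "integrable M h" for h
        by (rule Bochner_Integration.integrable_bound[of _ "\<lambda>x. h x / m"])
           (use that mp in \<open>auto simp: abs_mult intro!: divide_right_mono mult_left_le u\<close>)
      have "(\<integral>x. (max 0 (g x) / m) *\<^sub>R u (Y x) \<partial>M) - (\<integral>x. (max 0 (- g x) / m) *\<^sub>R u (Y x) \<partial>M)
        = (\<integral>x. (max 0 (g x) / m) *\<^sub>R u (Y x) - (max 0 (- g x) / m) *\<^sub>R u (Y x) \<partial>M)"
        by (rule Bochner_Integration.integral_diff[symmetric]) (intro i gpi gmi)+
      also have "\<dots> = (\<integral>x. (g x *\<^sub>R u (Y x)) /\<^sub>R m \<partial>M)"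
      proof (intro Bochner_Integration.integral_cong refl)
        fix x
        have "max 0 (g x) / m - max 0 (- g x) / m = g x / m"
          by (simp only: diff diff_divide_distrib[symmetric])
        then show "(max 0 (g x) / m) *\<^sub>R u (Y x) - (max 0 (- g x) / m) *\<^sub>R u (Y x) = (g x *\<^sub>R u (Y x)) /\<^sub>R m"
          by (simp only: scaleR_diff_left[symmetric]) (simp add: divide_inverse mult.commute)
      qed
      finally show ?thesis by (simp only: integral_scaleR_right)
    qed
    have "char (N (\<lambda>x. max 0 (g x))) = char (N (\<lambda>x. max 0 (- g x)))"
    proof
      fix t
      show "char (N (\<lambda>x. max 0 (g x))) t = char (N (\<lambda>x. max 0 (- g x))) t"
        using split_eq[of "\<lambda>y. iexp (t * y)"] chr[of t]
        unfolding char_def by (subst (1 2) Nint) (auto simp: scaleR_conv_of_real)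
    qed
    then have "N (\<lambda>x. max 0 (g x)) = N (\<lambda>x. max 0 (- g x))"
      by (intro Levy_uniqueness N gpi gmi) (auto simp: m_def gm[unfolded m_def])
    then have "integral\<^sup>L (N (\<lambda>x. max 0 (g x))) (indicator B) = integral\<^sup>L (N (\<lambda>x. max 0 (- g x))) (indicator B :: real \<Rightarrow> real)"
      by simp
    then show ?thesis
      using split_eq[of "indicator B :: real \<Rightarrow> real"] mp
      by (subst (asm) (1 2) Nint) (auto simp: indicator_def)
  qed
qed

text \<open>The exponentials \<open>exp (a \<bullet> x)\<close> are exchanged for indicators of boxes one coordinate at a time.\<close>
lemma laplace_transform_eq_0_imp_AE_eq_0:
  fixes M :: "'a::euclidean_space measure" and f :: "'a \<Rightarrow> real"
  assumes sets[measurable_cong]: "sets M = sets borel" and [measurable]: "f \<in> borel_measurable M"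
    and int: "\<And>k. integrable M (\<lambda>x. f x * exp (k * norm x))"
    and zero: "\<And>a. (\<integral>x. f x * exp (a \<bullet> x) \<partial>M) = 0"
  shows "AE x in M. f x = 0"
proof -
  have fi: "integrable M f" using int[of 0] by simp
  have ex: "\<bar>a \<bullet> x\<bar> \<le> norm a * norm x" for a x :: 'a by (rule Cauchy_Schwarz_ineq2)
  \<comment> \<open>The exponent \<open>a\<close> stays arbitrary in the induction: a factor
    \<open>exp (t * (x \<bullet> c))\<close> in the new coordinate \<open>c\<close> is absorbed by
    passing from \<open>a\<close> to \<open>a + t *\<^sub>R c\<close>.\<close>
  have partial: "(\<integral>x. f x * exp (a \<bullet> x) * (\<Prod>b\<in>J. indicator (B b) (x \<bullet> b)) \<partial>M) = 0"
    if "finite J" "J \<subseteq> Basis" "\<And>b. B b \<in> sets borel" for J and B :: "'a \<Rightarrow> real set" and a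
    using that
  proof (induction J arbitrary: a)
    case empty
    then show ?case using zero by simp
  next
    case (insert c J)
    note [measurable] = insert.prems(2)
    define g where "g = (\<lambda>x. f x * exp (a \<bullet> x) * (\<Prod>b\<in>J. indicator (B b) (x \<bullet> b)))"
    have [measurable]: "g \<in> borel_measurable M"
      unfolding g_def by measurable
    have le1: "\<bar>\<Prod>b\<in>J. indicator (B b) (x \<bullet> b) :: real\<bar> \<le> 1" for x
      by (simp add: abs_prod prod_le_1)
    have "(\<integral>x. g x * indicator (B c) (x \<bullet> c) \<partial>M) = 0"
    proof (rule exp_integral_eq_0_imp_fibre_integral_eq_0)
      fix k :: real
      show "integrable M (\<lambda>x. g x * exp (k * \<bar>x \<bullet> c\<bar>))"
      proof (rule Bochner_Integration.integrable_bound[OF int[of "norm a + \<bar>k\<bar>"]])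
        show "AE x in M. norm (g x * exp (k * \<bar>x \<bullet> c\<bar>)) \<le> norm (f x * exp ((norm a + \<bar>k\<bar>) * norm x))"
        proof (rule AE_I2)
          fix x
          have "k * \<bar>x \<bullet> c\<bar> \<le> \<bar>k\<bar> * norm x"
            using ex[of x c] insert.prems(1) by (intro mult_mono) auto
          moreover have "a \<bullet> x \<le> norm a * norm x" using ex[of a x] by simp
          ultimately have "exp (a \<bullet> x) * exp (k * \<bar>x \<bullet> c\<bar>) \<le> exp ((norm a + \<bar>k\<bar>) * norm x)"
            by (simp add: distrib_right flip: exp_add)
          then have "\<bar>f x\<bar> * (exp (a \<bullet> x) * exp (k * \<bar>x \<bullet> c\<bar>)) * \<bar>\<Prod>b\<in>J. indicator (B b) (x \<bullet> b)\<bar>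
              \<le> \<bar>f x\<bar> * exp ((norm a + \<bar>k\<bar>) * norm x) * 1"
            using le1 by (intro mult_mono mult_left_mono) auto
          then show "norm (g x * exp (k * \<bar>x \<bullet> c\<bar>)) \<le> norm (f x * exp ((norm a + \<bar>k\<bar>) * norm x))"
            by (simp add: g_def abs_mult mult_ac)
        qed
      qed simp
      fix t :: real
      have "(\<integral>x. g x * exp (t * (x \<bullet> c)) \<partial>M) =
          (\<integral>x. f x * exp ((a + t *\<^sub>R c) \<bullet> x) * (\<Prod>b\<in>J. indicator (B b) (x \<bullet> b)) \<partial>M)"
        by (intro Bochner_Integration.integral_cong)
           (simp_all add: g_def inner_add_left inner_add_right exp_add mult_ac inner_commute)
      also have "\<dots> = 0" using insert by auto
      finally show "(\<integral>x. g x * exp (t * (x \<bullet> c)) \<partial>M) = 0" .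
    qed auto
    then show ?case using insert by (simp add: g_def mult_ac)
  qed
  \<comment> \<open>Boxes with arbitrary Borel sides form an intersection-stable generator of the
    Borel sets, and \<open>partial\<close> with all coordinates treated covers exactly these. A
    Dynkin argument then reaches every Borel set.\<close>
  define E where "E = {{x::'a. \<forall>b\<in>Basis. x \<bullet> b \<in> B b} |B. \<forall>b. B b \<in> sets (borel :: real measure)}"
  have E_borel: "E \<subseteq> sets borel"
  proof
    fix X assume "X \<in> E"
    then obtain B where X: "X = {x. \<forall>b\<in>Basis. x \<bullet> b \<in> B b}" and B[measurable]: "\<And>b. B b \<in> sets borel"
      unfolding E_def by auto
    show "X \<in> sets borel" unfolding X by measurable
  qed
  have E_box: "box a b \<in> E" for a b
    unfolding E_def mem_Collect_eq
    by (rule exI[of _ "\<lambda>c. {a \<bullet> c <..< b \<bullet> c}"]) (auto simp: box_def)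
  have E_borel_eq: "sets borel = sigma_sets UNIV E"
  proof
    have "sets (borel :: 'a measure) = sigma_sets UNIV (range (\<lambda>(a, b). box a b))"
      unfolding borel_eq_box by simp
    also have "\<dots> \<subseteq> sigma_sets UNIV E" by (intro sigma_sets_mono') (use E_box in auto)
    finally show "sets borel \<subseteq> sigma_sets UNIV E" .
    show "sigma_sets UNIV E \<subseteq> sets borel"
      using E_borel sets.sigma_sets_subset[of E "borel :: 'a measure"] by simp
  qed
  have E_int: "Int_stable E"
  proof (rule Int_stableI)
    fix X Y assume "X \<in> E" "Y \<in> E"
    then obtain B C where "X = {x. \<forall>b\<in>Basis. x \<bullet> b \<in> B b}" "Y = {x. \<forall>b\<in>Basis. x \<bullet> b \<in> C b}"
      "\<And>b. B b \<in> sets borel" "\<And>b. C b \<in> sets borel" unfolding E_def by auto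
    then show "X \<inter> Y \<in> E" unfolding E_def mem_Collect_eq
      by (intro exI[of _ "\<lambda>b. B b \<inter> C b"]) auto
  qed
  have E_zero: "(\<integral>x. f x * indicator X x \<partial>M) = 0" if "X \<in> E" for X
  proof -
    have "\<exists>B. X = {x. \<forall>b\<in>Basis. x \<bullet> b \<in> B b} \<and> (\<forall>b. B b \<in> sets (borel :: real measure))"
      using that by (simp only: E_def mem_Collect_eq)
    then obtain B where X: "X = {x. \<forall>b\<in>Basis. x \<bullet> b \<in> B b}"
      and B: "\<forall>b. B b \<in> sets (borel :: real measure)"
      by (elim exE conjE)
    have "indicator X x = (\<Prod>b\<in>Basis. indicator (B b) (x \<bullet> b) :: real)" for x
    proof (cases "x \<in> X")
      case True
      then have "\<forall>b\<in>Basis. x \<bullet> b \<in> B b" by (simp add: X)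
      then have "(\<Prod>b\<in>Basis. indicator (B b) (x \<bullet> b) :: real) = 1" by (intro prod.neutral) simp
      with True show ?thesis by simp
    next
      case False
      then obtain b where "b \<in> Basis" "x \<bullet> b \<notin> B b" unfolding X by blast
      then have "(\<Prod>b\<in>Basis. indicator (B b) (x \<bullet> b) :: real) = 0"
        by (intro prod_zero bexI[of _ b]) auto
      with False show ?thesis by simp
    qed
    moreover have "(\<integral>x. f x * exp (0 \<bullet> x) * (\<Prod>b\<in>Basis. indicator (B b) (x \<bullet> b)) \<partial>M) = 0"
      using B by (intro partial) simp_all
    ultimately show ?thesis by simp
  qed
  have ind_int: "integrable M (\<lambda>x. f x * indicator X x)" if "X \<in> sets borel" for X
    using integrable_real_mult_indicator[of X M f] that fi by (simp add: sets)
  have UNIV_zero: "(\<integral>x. f x \<partial>M) = 0" using zero[of 0] by simp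
  have all: "(\<integral>x. f x * indicator X x \<partial>M) = 0" if "X \<in> sets borel" for X
  proof -
    have "E \<subseteq> Pow UNIV" by simp
    from E_int this that[unfolded E_borel_eq] show ?thesis
    proof (induction rule: sigma_sets_induct_disjoint)
      case (basic A)
      then show ?case by (rule E_zero)
    next
      case empty
      then show ?case by simp
    next
      case (compl A)
      then have A: "A \<in> sets borel" unfolding E_borel_eq by simp
      have "(\<integral>x. f x * indicator (UNIV - A) x \<partial>M) = (\<integral>x. f x - f x * indicator A x \<partial>M)"
        by (intro Bochner_Integration.integral_cong) (auto simp: indicator_def)
      also have "\<dots> = 0" using compl UNIV_zero fi ind_int[OF A] by simp
      finally show ?case .
    next
      case (union A)
      then have A: "A i \<in> sets M" for i unfolding sets E_borel_eq by auto
      have "(LINT x:(\<Union>i. A i)|M. f x) = (\<Sum>i. LINT x:A i|M. f x)"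
      proof (rule lebesgue_integral_countable_add)
        show "A i \<inter> A j = {}" if "i \<noteq> j" for i j
          using union(1) that by (auto simp: disjoint_family_on_def)
        have "(\<Union>i. A i) \<in> sets M" using A by auto
        then show "set_integrable M (\<Union>i. A i) f"
          unfolding set_integrable_def using integrable_mult_indicator fi by blast
      qed (rule A)
      then show ?case using union(3) by (simp add: set_lebesgue_integral_def mult.commute)
    qed
  qed
  show ?thesis
  proof (rule density_unique_real)
    show "integrable M f" "integrable M (\<lambda>x. 0::real)" using fi by auto
    show "(LINT x:A|M. f x) = (LINT x:A|M. 0)" if "A \<in> sets M" for A
      using all[of A] that sets by (simp add: set_lebesgue_integral_def mult.commute)
  qed
qed

section \<open>Positive definite matrices and block projections\<close>

lemma pos_def_matrix_sym:
  fixes S :: "real^'d^'d"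
  assumes "pos_def_matrix S"
  shows "x \<bullet> (S *v y) = y \<bullet> (S *v x)"
proof -
  have "x \<bullet> (S *v y) = (transpose S *v x) \<bullet> y"
    by (metis dot_lmul_matrix transpose_matrix_vector)
  also have "transpose S = S" using assms by (simp add: pos_def_matrix_def)
  finally show ?thesis by (simp only: inner_commute)
qed

lemma pos_def_matrix_nonneg:
  fixes S :: "real^'d^'d"
  assumes "pos_def_matrix S"
  shows "0 \<le> x \<bullet> (S *v x)"
  using assms by (cases "x = 0") (auto simp: pos_def_matrix_def intro: less_imp_le)

text \<open>By compactness the quadratic form has a positive minimum on the unit sphere; homogeneity
  extends the bound to all vectors.\<close>

lemma pos_def_matrix_coercive:
  fixes S :: "real^'d^'d"
  assumes "pos_def_matrix S"
  obtains c where "c > 0" "\<And>x. c * (norm x)\<^sup>2 \<le> x \<bullet> (S *v x)"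
proof -
  have "\<exists>x\<in>sphere 0 1. \<forall>y\<in>sphere 0 1. x \<bullet> (S *v x) \<le> y \<bullet> (S *v (y :: real^'d))"
    by (intro continuous_attains_inf continuous_intros)
       (auto intro!: matrix_vector_mult_linear_continuous_on)
  then obtain u :: "real^'d" where u: "norm u = 1"
    and min: "\<And>y. norm y = 1 \<Longrightarrow> u \<bullet> (S *v u) \<le> y \<bullet> (S *v y)"
    by auto
  have "u \<noteq> 0" using u by (metis norm_zero zero_neq_one)
  show thesis
  proof
    show "u \<bullet> (S *v u) > 0" using assms \<open>u \<noteq> 0\<close> by (simp add: pos_def_matrix_def)
    show "u \<bullet> (S *v u) * (norm x)\<^sup>2 \<le> x \<bullet> (S *v x)" for x
    proof (cases "x = 0")
      case False
      have "u \<bullet> (S *v u) \<le> (x /\<^sub>R norm x) \<bullet> (S *v (x /\<^sub>R norm x))"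
        using False by (intro min) simp
      also have "\<dots> = (x \<bullet> (S *v x)) / (norm x)\<^sup>2"
        by (simp add: matrix_vector_mult_scaleR power2_eq_square divide_inverse mult_ac)
      finally show ?thesis using False by (simp add: pos_le_divide_eq)
    qed simp
  qed
qed

lemma pos_def_matrix_eq_0_iff:
  fixes S :: "real^'d^'d"
  assumes "pos_def_matrix S"
  shows "x \<bullet> (S *v x) = 0 \<longleftrightarrow> x = 0"
  using assms by (auto simp: pos_def_matrix_def)

lemma pos_def_matrix_invertible:
  fixes S :: "real^'d^'d"
  assumes "pos_def_matrix S"
  shows "invertible S"
proof -
  have "x = y" if "S *v x = S *v y" for x y
    using that pos_def_matrix_eq_0_iff[OF assms, of "x - y"] by (simp add: matrix_vector_mult_diff_distrib)
  then have "inj ((*v) S)" by (rule injI)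
  then show ?thesis
    by (simp add: invertible_left_inverse matrix_left_invertible_injective)
qed

lemma invertible_matrix_inv:
  fixes A :: "real^'n^'n"
  assumes "invertible A"
  shows "A ** matrix_inv A = mat 1" "matrix_inv A ** A = mat 1"
  using someI_ex[OF assms[unfolded invertible_def]] unfolding matrix_inv_def by auto

lemma pos_def_matrix_inv:
  fixes S :: "real^'d^'d"
  assumes "pos_def_matrix S"
  shows "S *v (matrix_inv S *v x) = x" "matrix_inv S *v (S *v x) = x"
  by (simp_all add: matrix_vector_mul_assoc invertible_matrix_inv pos_def_matrix_invertible assms)

lemma pos_def_matrix_matrix_inv:
  fixes S :: "real^'d^'d"
  assumes "pos_def_matrix S"
  shows "pos_def_matrix (matrix_inv S)"
  unfolding pos_def_matrix_def
proof (intro conjI allI impI)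
  have inv: "S ** matrix_inv S = mat 1" "matrix_inv S ** S = mat 1"
    by (intro invertible_matrix_inv pos_def_matrix_invertible assms)+
  have "transpose (matrix_inv S) ** S = mat 1"
    using arg_cong[OF inv(1), of transpose] assms
    by (simp add: matrix_transpose_mul pos_def_matrix_def)
  then have "transpose (matrix_inv S) ** S ** matrix_inv S = matrix_inv S" by simp
  then show "transpose (matrix_inv S) = matrix_inv S"
    using inv(1) by (simp flip: matrix_mul_assoc)
  fix x :: "real^'d" assume "x \<noteq> 0"
  then have "matrix_inv S *v x \<noteq> 0"
    using pos_def_matrix_inv(1)[OF assms, of x] by auto
  then have "0 < (matrix_inv S *v x) \<bullet> (S *v (matrix_inv S *v x))"
    using assms by (simp add: pos_def_matrix_def)
  then show "0 < x \<bullet> (matrix_inv S *v x)"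
    using pos_def_matrix_inv(1)[OF assms, of x] by (simp add: inner_commute)
qed

text \<open>The segment from the identity to \<open>S\<close> consists of positive definite, hence invertible, matrices,
  so the determinant cannot change sign along it.\<close>
lemma pos_def_matrix_det_pos:
  fixes S :: "real^'d^'d"
  assumes "pos_def_matrix S"
  shows "det S > 0"
proof (rule ccontr)
  assume "\<not> det S > 0"
  define C where "C t = (1 - t) *\<^sub>R mat 1 + t *\<^sub>R S" for t :: real
  have Cv: "C t *v x = (1 - t) *\<^sub>R x + t *\<^sub>R (S *v x)" for t x
    by (simp add: C_def matrix_vector_mult_add_rdistrib scaleR_matrix_vector_assoc[symmetric])
  have "continuous_on {0..1} (\<lambda>t. det (C t))"
    unfolding det_def C_def by (simp, intro continuous_intros)
  then obtain t where t: "0 \<le> t" "t \<le> 1" "det (C t) = 0"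
    using IVT2'[of "\<lambda>t. det (C t)" 1 0 0] \<open>\<not> det S > 0\<close> by (auto simp: C_def)
  have "pos_def_matrix (C t)"
    unfolding pos_def_matrix_def
  proof (intro conjI allI impI)
    show "transpose (C t) = C t"
      using assms by (simp add: C_def transpose_def pos_def_matrix_def vec_eq_iff mat_def)
    fix x :: "real^'d" assume "x \<noteq> 0"
    then have "0 < x \<bullet> x" "0 < x \<bullet> (S *v x)" using assms by (auto simp: pos_def_matrix_def)
    then have "0 < (1 - t) * (x \<bullet> x) + t * (x \<bullet> (S *v x))"
      using t by (cases "t = 0") (auto intro: add_nonneg_pos)
    then show "0 < x \<bullet> (C t *v x)" by (simp add: Cv inner_add_right)
  qed
  then show False
    using pos_def_matrix_invertible invertible_det_nz t(3) by blast
qed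

text \<open>The projection onto \<open>{a. a\<^sub>j = 0 for j in block i}\<close>, orthogonal for the inner product \<open>(a, b) \<mapsto> a \<bullet> S b\<close>.\<close>
definition block_proj :: "real^'d^'d \<Rightarrow> ('d \<Rightarrow> nat) \<Rightarrow> nat \<Rightarrow> real^'d \<Rightarrow> real^'d" where
  "block_proj S blk i = (SOME P. linear P \<and>
     (\<forall>a j. (blk j = i \<longrightarrow> P a $ j = 0) \<and> (blk j \<noteq> i \<longrightarrow> (S *v (a - P a)) $ j = 0)))"

text \<open>The two conditions on \<open>P a\<close> form a square linear system
  \<open>T (P a) = R a\<close>. Here \<open>T\<close> is injective: if \<open>T a = 0\<close>, then
  for each \<open>j\<close> either \<open>a $ j\<close> or \<open>(S *v a) $ j\<close> is zero, so
  \<open>a \<bullet> (S *v a) = 0\<close>.\<close>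

lemma block_proj_exists:
  fixes S :: "real^'d^'d"
  assumes "pos_def_matrix S"
  shows "\<exists>P. linear P \<and>
     (\<forall>a j. (blk j = i \<longrightarrow> P a $ j = 0) \<and> (blk j \<noteq> i \<longrightarrow> (S *v (a - P a)) $ j = 0))"
proof -
  define T where "T a = (\<chi> j. if blk j = i then a $ j else (S *v a) $ j)" for a :: "real^'d"
  define R where "R a = (\<chi> j. if blk j = i then 0 else (S *v a) $ j)" for a :: "real^'d"
  have T: "linear T"
    by (rule linearI) (auto simp: T_def vec_eq_iff matrix_vector_right_distrib matrix_vector_mult_scaleR)
  have R: "linear R"
    by (rule linearI) (auto simp: R_def vec_eq_iff matrix_vector_right_distrib matrix_vector_mult_scaleR)
  have "inj T"
  proof (subst linear_injective_0[OF T], intro allI impI)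
    fix a assume "T a = 0"
    then have "a $ j * (S *v a) $ j = 0" for j
      by (auto simp: T_def vec_eq_iff split: if_splits)
    then have "a \<bullet> (S *v a) = 0" unfolding inner_vec_def inner_real_def by (intro sum.neutral) simp
    then show "a = 0" using pos_def_matrix_eq_0_iff[OF assms] by simp
  qed
  then obtain G where G: "linear G" "\<And>x. T (G x) = x"
    using linear_injective_isomorphism[OF T] by auto
  have TP: "T ((G \<circ> R) a) $ j = R a $ j" for a j by (simp add: G)
  show ?thesis
  proof (intro exI[of _ "G \<circ> R"] conjI allI impI)
    show "linear (G \<circ> R)" using R G(1) by (rule linear_compose)
    show "(G \<circ> R) a $ j = 0" if "blk j = i" for a j
      using TP[of a j] that by (simp add: T_def R_def)
    show "(S *v (a - (G \<circ> R) a)) $ j = 0" if "blk j \<noteq> i" for a j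
      using TP[of a j] that by (simp add: T_def R_def matrix_vector_mult_diff_distrib)
  qed
qed

context
  fixes S :: "real^'d^'d" and blk :: "'d \<Rightarrow> nat" and i :: nat
  assumes pd: "pos_def_matrix S"
begin

lemma block_proj_linear: "linear (block_proj S blk i)"
  and block_proj_in_block: "blk j = i \<Longrightarrow> block_proj S blk i a $ j = 0"
  and block_proj_residual: "blk j \<noteq> i \<Longrightarrow> (S *v (a - block_proj S blk i a)) $ j = 0"
  using someI_ex[OF block_proj_exists[OF pd, of blk i]] unfolding block_proj_def by auto

text \<open>The supports are disjoint: the first factor vanishes on block \<open>i\<close>, the
  second one off it.\<close>

lemma block_proj_orthogonal: "block_proj S blk i b \<bullet> (S *v (a - block_proj S blk i a)) = 0"
proof -
  have "block_proj S blk i b $ j * (S *v (a - block_proj S blk i a)) $ j = 0" for j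
    using block_proj_in_block[of j b] block_proj_residual[of j a] by (cases "blk j = i") auto
  then show ?thesis unfolding inner_vec_def inner_real_def by (intro sum.neutral) simp
qed

text \<open>Self-adjointness of the projection for the inner product given by \<open>S\<close>,
  stated so that the right-hand side is visibly symmetric in \<open>a\<close> and
  \<open>b\<close>.\<close>

lemma block_proj_sym: "b \<bullet> (S *v block_proj S blk i a) = block_proj S blk i b \<bullet> (S *v block_proj S blk i a)"
proof -
  have "(b - block_proj S blk i b) \<bullet> (S *v block_proj S blk i a) = 0"
    using block_proj_orthogonal[of a b] pos_def_matrix_sym[OF pd] by metis
  then show ?thesis by (simp add: inner_diff_left)
qed

text \<open>Pythagoras: the difference of the two sides is the squared \<open>S\<close>-length of
  the residual.\<close>

lemma block_proj_contraction:
  "block_proj S blk i a \<bullet> (S *v block_proj S blk i a) \<le> a \<bullet> (S *v a)"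
proof -
  have "a \<bullet> (S *v a) - block_proj S blk i a \<bullet> (S *v block_proj S blk i a)
      = (a - block_proj S blk i a) \<bullet> (S *v (a - block_proj S blk i a))"
    using block_proj_sym[of a a] pos_def_matrix_sym[OF pd, of "block_proj S blk i a" a]
    by (simp add: matrix_vector_mult_diff_distrib inner_diff_left inner_diff_right)
  then show ?thesis
    using pos_def_matrix_nonneg[OF pd, of "a - block_proj S blk i a"] by linarith
qed

end

section \<open>Rayleigh quotients and the functional equation\<close>

text \<open>The Rayleigh quotient attains its maximum \<open>l\<close> on the compact unit sphere,
  and the first variation at a maximizer shows that it is an eigenvector.\<close>

lemma max_rayleigh_eigenvector:
  fixes S :: "real^'d^'d" and K :: "real^'d \<Rightarrow> real^'d"
  assumes pd: "pos_def_matrix S" and K: "linear K"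
    and sym: "\<And>a b. a \<bullet> (S *v K b) = b \<bullet> (S *v K a)"
  obtains l a where "a \<noteq> 0" "K a = l *\<^sub>R a" "\<And>b. b \<bullet> (S *v K b) \<le> l * (b \<bullet> (S *v b))"
proof -
  have contK: "continuous_on A K" for A by (rule linear_continuous_on) (simp add: K linear_conv_bounded_linear[symmetric])
  have contS: "continuous_on A (\<lambda>x. S *v f x)" if "continuous_on A f" for A and f :: "real^'d \<Rightarrow> real^'d"
    by (rule continuous_on_compose2[OF matrix_vector_mult_linear_continuous_on that subset_UNIV])
  have S0: "x \<bullet> (S *v x) \<noteq> 0" if "x \<in> sphere 0 1" for x
    using that pos_def_matrix_eq_0_iff[OF pd, of x] by auto
  have "\<exists>x\<in>sphere 0 1. \<forall>y\<in>sphere 0 1.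
      (y \<bullet> (S *v K y)) / (y \<bullet> (S *v y)) \<le> (x \<bullet> (S *v K x)) / (x \<bullet> (S *v (x :: real^'d)))"
    using S0 by (intro continuous_attains_sup continuous_intros contS contK) auto
  then obtain a where a: "norm a = 1" and max: "\<And>y. norm y = 1 \<Longrightarrow>
      (y \<bullet> (S *v K y)) / (y \<bullet> (S *v y)) \<le> (a \<bullet> (S *v K a)) / (a \<bullet> (S *v a))"
    by auto
  define l where "l = (a \<bullet> (S *v K a)) / (a \<bullet> (S *v a))"
  have le: "b \<bullet> (S *v K b) \<le> l * (b \<bullet> (S *v b))" for b
  proof (cases "b = 0")
    case True
    then show ?thesis by simp
  next
    case False
    have pos: "0 < b \<bullet> (S *v b)" using False pd by (simp add: pos_def_matrix_def)
    have "(b \<bullet> (S *v K b)) / (b \<bullet> (S *v b)) \<le> l"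
      using max[of "b /\<^sub>R norm b"] False
      by (simp add: l_def matrix_vector_mult_scaleR linear_scale[OF K])
    then show ?thesis using pos by (simp add: pos_divide_le_eq)
  qed
  have a0: "a \<noteq> 0" using a by auto
  have Ba: "a \<bullet> (S *v K a) = l * (a \<bullet> (S *v a))"
    using a0 pos_def_matrix_eq_0_iff[OF pd] by (simp add: l_def)
  define w where "w = l *\<^sub>R a - K a"
  \<comment> \<open>The form \<open>l * (x \<bullet> (S *v x)) - x \<bullet> (S *v K x)\<close> is
    nonnegative and vanishes at \<open>a\<close>. Along \<open>a + t *\<^sub>R b\<close> its linear
    coefficient in \<open>t\<close> must therefore be zero.\<close>
  have cross: "b \<bullet> (S *v w) = 0" for b
  proof (rule ccontr)
    assume ne: "b \<bullet> (S *v w) \<noteq> 0"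
    define D where "D = l * (b \<bullet> (S *v b)) - b \<bullet> (S *v K b)"
    have D0: "0 \<le> D" using le[of b] by (simp add: D_def)
    have *: "0 \<le> 2 * t * (b \<bullet> (S *v w)) + t\<^sup>2 * D" for t
    proof -
      have "0 \<le> l * ((a + t *\<^sub>R b) \<bullet> (S *v (a + t *\<^sub>R b))) - (a + t *\<^sub>R b) \<bullet> (S *v K (a + t *\<^sub>R b))"
        using le[of "a + t *\<^sub>R b"] by simp
      also have "\<dots> = 2 * t * (b \<bullet> (S *v w)) + t\<^sup>2 * D"
        using Ba sym[of a b] pos_def_matrix_sym[OF pd, of a b]
        by (simp add: w_def D_def linear_add[OF K] linear_scale[OF K] power2_eq_square algebra_simps)
      finally show ?thesis .
    qed
    define e where "e = b \<bullet> (S *v w)"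
    \<comment> \<open>Close to the minimizer \<open>- e / D\<close> of the quadratic; the shift by 1
      keeps the denominator positive when \<open>D = 0\<close>.\<close>
    define t where "t = - e / (D + 1)"
    have et: "e = - t * (D + 1)" using D0 by (simp add: t_def)
    have "0 \<le> 2 * t * e + t\<^sup>2 * D" using * unfolding e_def by blast
    also have "\<dots> = - (t\<^sup>2 * (D + 2))" by (simp add: et power2_eq_square algebra_simps)
    finally have "t\<^sup>2 * (D + 2) \<le> 0" by simp
    then have "t = 0" using D0 by (simp add: mult_le_0_iff)
    then show False using ne et by (simp add: e_def)
  qed
  have "w = 0" using cross[of w] pos_def_matrix_eq_0_iff[OF pd] by simp
  then show thesis using a0 le by (intro that[of a l]) (auto simp: w_def)
qed

text \<open>Evaluating the functional equation to first order at the origin shows that the linear part of \<open>F\<close> is an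
  eigenvector for \<open>\<mu>\<close>, hence zero; then \<open>F\<close> is of second order, and each application of the
  equation shrinks the quadratic bound by the factor \<open>l / \<mu> < 1\<close>.\<close>
lemma functional_equation_imp_zero:
  fixes S :: "real^'d^'d" and F :: "real^'d \<Rightarrow> real" and Q :: "nat \<Rightarrow> real^'d \<Rightarrow> real^'d"
  assumes pd: "pos_def_matrix S"
    and p: "\<And>i. i < s \<Longrightarrow> 0 \<le> p i"
    and lin: "\<And>i. linear (Q i)"
    and sym: "\<And>i a b. b \<bullet> (S *v Q i a) = Q i b \<bullet> (S *v Q i a)"
    and contr: "\<And>i a. Q i a \<bullet> (S *v Q i a) \<le> a \<bullet> (S *v a)"
    and rayleigh: "\<And>a. (\<Sum>i<s. p i * (Q i a \<bullet> (S *v Q i a))) \<le> l * (a \<bullet> (S *v a))"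
    and l: "0 \<le> l" "l < \<mu>"
    and eq: "\<And>a. \<mu> * F a = (\<Sum>i<s. p i * F (Q i a))"
    and approx: "\<And>r. \<exists>C. \<forall>a. a \<bullet> (S *v a) \<le> r \<longrightarrow> \<bar>F a - v \<bullet> a\<bar> \<le> C * (a \<bullet> (S *v a))"
  shows "F a = 0"
proof -
  define q where "q a = a \<bullet> (S *v a)" for a
  have q0: "0 \<le> q a" for a using pos_def_matrix_nonneg[OF pd] by (simp add: q_def)
  have qscale: "q (t *\<^sub>R a) = t\<^sup>2 * q a" for t a
    by (simp add: q_def matrix_vector_mult_scaleR power2_eq_square)
  have lin_eq: "\<mu> * (v \<bullet> a) = (\<Sum>i<s. p i * (v \<bullet> Q i a))" for a
  proof -
    obtain C where C: "\<And>b. q b \<le> q a \<Longrightarrow> \<bar>F b - v \<bullet> b\<bar> \<le> C * q b"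
      using approx[of "q a"] unfolding q_def by auto
    define d where "d = \<mu> * (v \<bullet> a) - (\<Sum>i<s. p i * (v \<bullet> Q i a))"
    define B where "B = \<mu> * C * q a + (\<Sum>i<s. p i * C * q (Q i a))"
    \<comment> \<open>At \<open>t *\<^sub>R a\<close> every value of \<open>F\<close> in the
      equation agrees with its linear part up to order \<open>t\<^sup>2\<close>, so the defect of
      the linear parts satisfies \<open>t * \<bar>d\<bar> \<le> t\<^sup>2 * B\<close>. Letting
      \<open>t\<close> tend to 0 from the right gives \<open>d = 0\<close>.\<close>
    have bound: "\<bar>d\<bar> \<le> t * B" if t: "0 < t" "t \<le> 1" for t
    proof -
      have t2: "t\<^sup>2 \<le> 1" using t by (simp add: power_le_one)
      have F: "\<bar>F (t *\<^sub>R b) - t * (v \<bullet> b)\<bar> \<le> t\<^sup>2 * (C * q b)" if "q b \<le> q a" for b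
      proof -
        have "q (t *\<^sub>R b) \<le> q a"
          using that t2 q0[of b] mult_right_mono[OF t2, of "q b"] by (simp add: qscale)
        from C[OF this] show ?thesis by (simp add: qscale mult_ac)
      qed
      have tQ: "F (Q i (t *\<^sub>R a)) = F (t *\<^sub>R Q i a)" for i by (simp add: linear_scale[OF lin])
      define X where "X = (\<Sum>i<s. p i * (F (t *\<^sub>R Q i a) - t * (v \<bullet> Q i a)))"
      define Y where "Y = \<mu> * (F (t *\<^sub>R a) - t * (v \<bullet> a))"
      have "t * d = X - Y"
        using eq[of "t *\<^sub>R a"]
        by (simp add: d_def X_def Y_def tQ right_diff_distrib sum_subtractf sum_distrib_left mult_ac)
      moreover have "t * \<bar>d\<bar> = \<bar>t * d\<bar>" using t by (simp add: abs_mult)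
      ultimately have "t * \<bar>d\<bar> \<le> \<bar>X\<bar> + \<bar>Y\<bar>" by linarith
      also have "\<bar>X\<bar> \<le> (\<Sum>i<s. \<bar>p i * (F (t *\<^sub>R Q i a) - t * (v \<bullet> Q i a))\<bar>)"
        unfolding X_def by (rule sum_abs)
      also have "\<dots> + \<bar>Y\<bar> \<le> (\<Sum>i<s. p i * (t\<^sup>2 * (C * q (Q i a)))) + \<mu> * (t\<^sup>2 * (C * q a))"
        unfolding Y_def
        using F p l contr by (intro add_mono sum_mono) (auto simp: abs_mult q_def intro!: mult_left_mono)
      also have "\<dots> = t * (t * B)"
        by (simp add: B_def sum_distrib_left distrib_left power2_eq_square mult_ac)
      finally show ?thesis using t by simp
    qed
    have "\<bar>d\<bar> \<le> 0"
    proof (rule tendsto_lowerbound)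
      show "((\<lambda>t. t * B) \<longlongrightarrow> 0) (at_right 0)"
        by (rule tendsto_eq_intros refl)+ simp
      show "\<forall>\<^sub>F t in at_right 0. \<bar>d\<bar> \<le> t * B"
        unfolding eventually_at_right_field using bound by (intro exI[of _ 1]) auto
    qed simp
    then show ?thesis by (simp add: d_def)
  qed
  have v0: "v = 0"
  proof -
    \<comment> \<open>The vector representing \<open>v\<close> in the inner product of
      \<open>S\<close>. Testing the linearized equation at \<open>b\<close> itself produces the
      Rayleigh form, so \<open>\<mu> * q b \<le> l * q b\<close>.\<close>
    define b where "b = matrix_inv S *v v"
    have Sb: "S *v b = v" by (simp add: b_def pos_def_matrix_inv[OF pd])
    have "\<mu> * q b = (\<Sum>i<s. p i * (Q i b \<bullet> (S *v Q i b)))"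
    proof -
      have "v \<bullet> Q i b = Q i b \<bullet> (S *v Q i b)" for i
        using sym[where i = i and a = b and b = b] pos_def_matrix_sym[OF pd, of b "Q i b"] Sb by (simp add: inner_commute)
      then show ?thesis using lin_eq[of b] Sb by (simp add: q_def inner_commute)
    qed
    also have "\<dots> \<le> l * q b" using rayleigh[of b] by (simp add: q_def)
    finally have "(\<mu> - l) * q b \<le> 0" by (simp add: left_diff_distrib)
    then have "q b = 0" using l q0[of b] by (simp add: mult_le_0_iff)
    then have "b = 0" using pos_def_matrix_eq_0_iff[OF pd] by (simp add: q_def)
    then show ?thesis using Sb by simp
  qed
  obtain C where C: "\<And>b. q b \<le> q a \<Longrightarrow> \<bar>F b\<bar> \<le> C * q b"
    using approx[of "q a"] v0 unfolding q_def by auto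
  \<comment> \<open>The contraction property keeps each \<open>Q i b\<close> inside the region where
    the constant \<open>C\<close> is valid, so the hypothesis can be applied again at every
    stage.\<close>
  have iter: "\<bar>F b\<bar> \<le> (l / \<mu>) ^ n * \<bar>C\<bar> * q b" if "q b \<le> q a" for n b
    using that
  proof (induction n arbitrary: b)
    case 0
    then show ?case
      using order.trans[OF C[of b] mult_right_mono[OF abs_ge_self q0]] by simp
  next
    case (Suc n)
    have "\<mu> * \<bar>F b\<bar> = \<bar>\<Sum>i<s. p i * F (Q i b)\<bar>"
      unfolding eq[of b, symmetric] using l by (simp add: abs_mult)
    also have "\<dots> \<le> (\<Sum>i<s. \<bar>p i * F (Q i b)\<bar>)" by (rule sum_abs)
    also have "\<dots> \<le> (\<Sum>i<s. p i * ((l / \<mu>) ^ n * \<bar>C\<bar> * q (Q i b)))"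
    proof (rule sum_mono)
      fix i assume i: "i \<in> {..<s}"
      have "q (Q i b) \<le> q a" using contr[of i b] Suc.prems by (simp add: q_def)
      from Suc.IH[OF this] show "\<bar>p i * F (Q i b)\<bar> \<le> p i * ((l / \<mu>) ^ n * \<bar>C\<bar> * q (Q i b))"
        using p[of i] i by (simp add: abs_mult mult_left_mono)
    qed
    also have "\<dots> = (l / \<mu>) ^ n * \<bar>C\<bar> * (\<Sum>i<s. p i * q (Q i b))"
      by (simp add: sum_distrib_left mult_ac)
    also have "\<dots> \<le> (l / \<mu>) ^ n * \<bar>C\<bar> * (l * q b)"
      using rayleigh[of b] l by (intro mult_left_mono) (auto simp: q_def)
    finally have "\<bar>F b\<bar> \<le> (l / \<mu>) ^ n * \<bar>C\<bar> * (l * q b) / \<mu>"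
      using l by (simp add: pos_le_divide_eq mult.commute)
    then show ?case by (simp add: mult_ac)
  qed
  have "\<bar>F a\<bar> \<le> 0"
  proof (rule LIMSEQ_le_const)
    have "(\<lambda>n. (l / \<mu>) ^ n) \<longlonglongrightarrow> 0" using l by (intro LIMSEQ_realpow_zero) auto
    from tendsto_mult_right[OF this, of "\<bar>C\<bar> * q a"]
    show "(\<lambda>n. (l / \<mu>) ^ n * \<bar>C\<bar> * q a) \<longlonglongrightarrow> 0" by (simp add: mult.assoc)
    show "\<exists>N. \<forall>n\<ge>N. \<bar>F a\<bar> \<le> (l / \<mu>) ^ n * \<bar>C\<bar> * q a" using iter by blast
  qed
  then show ?thesis by simp
qed

section \<open>Exponential tilts of the Gaussian measure\<close>

text \<open>The normalizing constant makes multiplication by \<open>tilt S a\<close> act on the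
  Gaussian density as translation by \<open>S *v a\<close>.\<close>

definition tilt :: "real^'d^'d \<Rightarrow> real^'d \<Rightarrow> real^'d \<Rightarrow> real" where
  "tilt S a x = exp (a \<bullet> x - (a \<bullet> (S *v a)) / 2)"

lemma tilt_pos: "0 < tilt S a x"
  by (simp add: tilt_def)

lemma tilt_0 [simp]: "tilt S 0 x = 1"
  by (simp add: tilt_def)

lemma continuous_on_matrix_vector_mult [continuous_intros]:
  fixes A :: "real^'n^'m"
  shows "continuous_on X f \<Longrightarrow> continuous_on X (\<lambda>x. A *v f x)"
  by (rule continuous_on_compose2[OF matrix_vector_mult_linear_continuous_on _ subset_UNIV])

lemma borel_measurable_tilt [measurable]: "tilt S a \<in> borel_measurable borel"
  unfolding tilt_def by (intro borel_measurable_continuous_onI continuous_intros)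

lemma borel_measurable_gauss_density [measurable]: "gauss_density S \<in> borel_measurable borel"
proof -
  have "(\<lambda>x. exp (- (x \<bullet> (matrix_inv S *v x)) / 2)) \<in> borel_measurable borel"
    by (intro borel_measurable_continuous_onI continuous_intros) simp
  then show ?thesis unfolding gauss_density_def by measurable
qed

lemma sets_gaussian [simp, measurable_cong]: "sets (gaussian S) = sets borel"
  by (simp add: gaussian_def)

lemma space_gaussian [simp]: "space (gaussian S) = UNIV"
  by (simp add: gaussian_def)

lemma measurable_gaussian: "measurable (gaussian S) N = measurable borel N"
  by (rule measurable_cong_sets) simp_all

text \<open>A crude second-order Taylor bound, obtained from \<open>1 + v \<le> exp v\<close> at
  \<open>v = u\<close> and \<open>v = - u\<close>. The factor \<open>exp \<bar>u\<bar>\<close> is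
  harmless under a Gaussian.\<close>

lemma exp_minus_one_minus_self_bound:
  fixes u :: real
  shows "\<bar>exp u - 1 - u\<bar> \<le> u\<^sup>2 * exp \<bar>u\<bar>"
proof -
  have 1: "exp u - 1 \<le> u * exp u"
  proof -
    have "(1 - u) * exp u \<le> exp (- u) * exp u"
      using exp_ge_add_one_self[of "- u"] by (intro mult_right_mono) auto
    then show ?thesis by (simp add: left_diff_distrib flip: exp_add)
  qed
  have 2: "0 \<le> exp u - 1 - u" using exp_ge_add_one_self[of u] by linarith
  show ?thesis
  proof (cases "0 \<le> u")
    case True
    have "exp u - 1 - u \<le> u * (exp u - 1)" using 1 by (simp add: right_diff_distrib)
    also have "\<dots> \<le> u * (u * exp u)" using 1 True by (intro mult_left_mono) auto
    finally show ?thesis using 2 True by (simp add: power2_eq_square mult.assoc)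
  next
    case False
    have "exp u - 1 - u \<le> u * (exp u - 1)" using 1 by (simp add: right_diff_distrib)
    also have "\<dots> = - u * (1 - exp u)" by (simp add: algebra_simps)
    also have "\<dots> \<le> - u * (- u)" using 2 False by (intro mult_left_mono) auto
    also have "\<dots> \<le> u\<^sup>2 * exp \<bar>u\<bar>"
      using mult_left_mono[of 1 "exp \<bar>u\<bar>" "u\<^sup>2"] by (simp add: power2_eq_square)
    finally show ?thesis using 2 by simp
  qed
qed

context
  fixes S :: "real^'d^'d"
  assumes pd: "pos_def_matrix S"
begin

lemma gauss_density_pos: "0 < gauss_density S x"
  using pos_def_matrix_det_pos[OF pd] by (simp add: gauss_density_def)

text \<open>Completing the square in the exponent.\<close>

lemma gauss_density_mult_tilt: "gauss_density S x * tilt S a x = gauss_density S (x - S *v a)"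
proof -
  have "(S *v a) \<bullet> (matrix_inv S *v x) = a \<bullet> x"
    using pos_def_matrix_sym[OF pos_def_matrix_matrix_inv[OF pd], of "S *v a" x] pos_def_matrix_inv[OF pd]
    by (simp add: inner_commute)
  then have "(x - S *v a) \<bullet> (matrix_inv S *v (x - S *v a)) = x \<bullet> (matrix_inv S *v x) - 2 * (a \<bullet> x) + a \<bullet> (S *v a)"
    by (simp add: matrix_vector_mult_diff_distrib inner_diff_left inner_diff_right pos_def_matrix_inv[OF pd] inner_commute)
  then have "exp (- (x \<bullet> (matrix_inv S *v x)) / 2) * exp (a \<bullet> x - a \<bullet> (S *v a) / 2)
      = exp (- ((x - S *v a) \<bullet> (matrix_inv S *v (x - S *v a))) / 2)"
    by (simp add: field_simps flip: exp_add)
  then show ?thesis by (simp add: gauss_density_def tilt_def)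
qed

text \<open>The Cameron--Martin formula: it turns everything needed about conditional distributions into
  translation invariance of Lebesgue measure.\<close>
lemma density_tilt: "density (gaussian S) (\<lambda>x. ennreal (tilt S a x)) = distr (gaussian S) borel (\<lambda>x. x + S *v a)"
proof (rule measure_eqI)
  fix X assume "X \<in> sets (density (gaussian S) (\<lambda>x. ennreal (tilt S a x)))"
  then have [measurable]: "X \<in> sets borel" by simp
  have "emeasure (density (gaussian S) (\<lambda>x. ennreal (tilt S a x))) X =
      (\<integral>\<^sup>+x. ennreal (gauss_density S x) * (ennreal (tilt S a x) * indicator X x) \<partial>lborel)"
    by (simp add: emeasure_density measurable_gaussian gaussian_def nn_integral_density)
  also have "\<dots> = (\<integral>\<^sup>+x. ennreal (gauss_density S (x - S *v a)) * indicator X x \<partial>lborel)"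
    by (simp add: gauss_density_mult_tilt[symmetric] gauss_density_pos tilt_pos less_imp_le ennreal_mult mult.assoc)
  also have "\<dots> = (\<integral>\<^sup>+x. ennreal (gauss_density S (x - S *v a)) * indicator X x \<partial>distr lborel borel ((+) (S *v a)))"
    by (simp add: lborel_distr_plus)
  also have "\<dots> = (\<integral>\<^sup>+x. ennreal (gauss_density S x) * indicator X (x + S *v a) \<partial>lborel)"
    by (subst nn_integral_distr) (simp_all add: add.commute)
  also have "\<dots> = (\<integral>\<^sup>+x. indicator X (x + S *v a) \<partial>gaussian S)"
    by (simp add: gaussian_def nn_integral_density)
  also have "\<dots> = (\<integral>\<^sup>+x. indicator X x \<partial>distr (gaussian S) borel (\<lambda>x. x + S *v a))"
    by (subst nn_integral_distr) simp_all
  also have "\<dots> = emeasure (distr (gaussian S) borel (\<lambda>x. x + S *v a)) X"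
    by simp
  finally show "emeasure (density (gaussian S) (\<lambda>x. ennreal (tilt S a x))) X = \<dots>" .
qed simp

lemma
  fixes h :: "real^'d \<Rightarrow> real"
  assumes [measurable]: "h \<in> borel_measurable borel"
  shows integrable_tilt_iff:
      "integrable (gaussian S) (\<lambda>x. h x * tilt S a x) \<longleftrightarrow> integrable (gaussian S) (\<lambda>x. h (x + S *v a))"
    and integral_tilt: "(\<integral>x. h x * tilt S a x \<partial>gaussian S) = (\<integral>x. h (x + S *v a) \<partial>gaussian S)"
proof -
  have "integrable (gaussian S) (\<lambda>x. h x * tilt S a x) \<longleftrightarrow> integrable (density (gaussian S) (\<lambda>x. ennreal (tilt S a x))) h"
    by (subst integrable_density) (auto simp: tilt_pos less_imp_le mult.commute)
  also have "\<dots> \<longleftrightarrow> integrable (gaussian S) (\<lambda>x. h (x + S *v a))"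
    unfolding density_tilt by (subst integrable_distr_eq) auto
  finally show "integrable (gaussian S) (\<lambda>x. h x * tilt S a x) \<longleftrightarrow> integrable (gaussian S) (\<lambda>x. h (x + S *v a))" .
  have "(\<integral>x. h x * tilt S a x \<partial>gaussian S) = integral\<^sup>L (density (gaussian S) (\<lambda>x. ennreal (tilt S a x))) h"
    by (subst integral_density) (auto simp: tilt_pos less_imp_le mult.commute)
  also have "\<dots> = (\<integral>x. h (x + S *v a) \<partial>gaussian S)"
    unfolding density_tilt by (subst integral_distr) auto
  finally show "(\<integral>x. h x * tilt S a x \<partial>gaussian S) = (\<integral>x. h (x + S *v a) \<partial>gaussian S)" .
qed

section \<open>Integrability and first moments under the Gaussian measure\<close>

text \<open>Coercivity of the inverse covariance bounds the exponent of the density by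
  \<open>- c / 2 * (norm x)\<^sup>2\<close>. Half of this absorbs \<open>k * norm x\<close> by
  completing a square; the other half factorizes over the coordinates into one-dimensional Gaussian
  integrals.\<close>

lemma gaussian_integrable_exp_norm: "integrable (gaussian S) (\<lambda>x. exp (k * norm x))"
proof -
  obtain c where c: "c > 0" "\<And>x. c * (norm x)\<^sup>2 \<le> x \<bullet> (matrix_inv S *v x)"
    using pos_def_matrix_coercive[OF pos_def_matrix_matrix_inv[OF pd]] by blast
  define Z where "Z = sqrt ((2 * pi) ^ CARD('d) * det S)"
  have Z: "0 < Z" using pos_def_matrix_det_pos[OF pd] by (simp add: Z_def)
  define C where "C = exp (k\<^sup>2 / c) / Z"
  have C: "0 \<le> C" using Z by (simp add: C_def)
  have prod: "exp (- (c / 4) * (norm x)\<^sup>2) = (\<Prod>b\<in>Basis. exp (- (c / 4) * (x \<bullet> b)\<^sup>2))" for x :: "real^'d"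
    unfolding norm_eq_sqrt_inner euclidean_inner[of x x]
    by (simp add: sum_nonneg sum_distrib_left power2_eq_square flip: exp_sum)
  have bound: "gauss_density S x * exp (k * norm x) \<le> C * exp (- (c / 4) * (norm x)\<^sup>2)" for x
  proof -
    have "0 \<le> (sqrt c / 2 * norm x - k / sqrt c)\<^sup>2" by simp
    also have "\<dots> = c / 4 * (norm x)\<^sup>2 - k * norm x + k\<^sup>2 / c"
      using c(1) by (simp add: power2_diff power_mult_distrib power_divide)
    finally have "- (x \<bullet> (matrix_inv S *v x)) / 2 + k * norm x \<le> k\<^sup>2 / c + - (c / 4) * (norm x)\<^sup>2"
      using c(2)[of x] by (simp add: field_simps)
    then have "exp (- (x \<bullet> (matrix_inv S *v x)) / 2) * exp (k * norm x) / Z \<le> exp (k\<^sup>2 / c) * exp (- (c / 4) * (norm x)\<^sup>2) / Z"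
      using Z by (intro divide_right_mono) (simp_all flip: exp_add)
    then show ?thesis by (simp add: gauss_density_def Z_def C_def)
  qed
  have one: "(\<integral>\<^sup>+x. ennreal (exp (- (c / 4) * x\<^sup>2)) \<partial>lborel) < \<infinity>"
  proof -
    \<comment> \<open>The standard deviation for which
      \<open>1 / (2 * s\<^sup>2) = c / 4\<close>.\<close>
    define s where "s = sqrt (2 / c)"
    have s: "0 < s" "s\<^sup>2 = 2 / c" using c(1) by (simp_all add: s_def)
    have "integrable lborel (\<lambda>x. normal_density 0 s x * sqrt (2 * pi * s\<^sup>2))"
      by (intro integrable_mult_left integrable_normal_density s)
    also have "(\<lambda>x. normal_density 0 s x * sqrt (2 * pi * s\<^sup>2)) = (\<lambda>x. exp (- (c / 4) * x\<^sup>2))"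
      using s c(1) by (auto simp: normal_density_def fun_eq_iff field_simps)
    finally show ?thesis by (subst (asm) integrable_iff_bounded) simp
  qed
  have "(\<integral>\<^sup>+x. ennreal (exp (- (c / 4) * (norm x)\<^sup>2)) \<partial>(lborel :: (real^'d) measure))
      = (\<integral>\<^sup>+x. (\<Prod>b\<in>Basis. ennreal (exp (- (c / 4) * (x \<bullet> b)\<^sup>2))) \<partial>(lborel :: (real^'d) measure))"
    unfolding prod by (simp add: prod_ennreal)
  also have "\<dots> = (\<Prod>b\<in>(Basis :: (real^'d) set). (\<integral>\<^sup>+x. ennreal (exp (- (c / 4) * x\<^sup>2)) \<partial>lborel))"
    by (rule nn_integral_lborel_prod) auto
  also have "\<dots> < \<infinity>" using one by (simp add: power_eq_top_ennreal less_top[symmetric])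
  finally have fin: "(\<integral>\<^sup>+x. ennreal (exp (- (c / 4) * (norm x)\<^sup>2)) \<partial>(lborel :: (real^'d) measure)) < \<infinity>" .
  have "(\<integral>\<^sup>+x. ennreal (exp (k * norm x)) \<partial>gaussian S) = (\<integral>\<^sup>+x. ennreal (gauss_density S x * exp (k * norm x)) \<partial>lborel)"
    by (simp add: gaussian_def nn_integral_density ennreal_mult gauss_density_pos less_imp_le)
  also have "\<dots> \<le> (\<integral>\<^sup>+x. ennreal C * ennreal (exp (- (c / 4) * (norm x)\<^sup>2)) \<partial>(lborel :: (real^'d) measure))"
    using bound C by (intro nn_integral_mono) (simp flip: ennreal_mult)
  also have "\<dots> = ennreal C * (\<integral>\<^sup>+x. ennreal (exp (- (c / 4) * (norm x)\<^sup>2)) \<partial>(lborel :: (real^'d) measure))"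
    by (rule nn_integral_cmult) simp
  also have "\<dots> < \<infinity>" using fin by (simp add: ennreal_mult_less_top)
  finally show ?thesis by (intro integrableI_nonneg) auto
qed

lemma finite_measure_gaussian: "finite_measure (gaussian S)"
proof -
  have "integrable (gaussian S) (\<lambda>x. 1 :: real)" using gaussian_integrable_exp_norm[of 0] by simp
  then show ?thesis
    by (intro finite_measureI) (auto simp: integrable_iff_bounded less_top)
qed

lemma gaussian_integrable_exp_bound:
  fixes g :: "real^'d \<Rightarrow> real"
  assumes "g \<in> borel_measurable borel" "\<And>x. \<bar>g x\<bar> \<le> C * exp (k * norm x)"
  shows "integrable (gaussian S) g"
  by (rule Bochner_Integration.integrable_bound[of _ "\<lambda>x. C * exp (k * norm x)"])
     (use assms gaussian_integrable_exp_norm in \<open>auto simp: measurable_gaussian intro: order.trans[OF _ abs_ge_self]\<close>)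

text \<open>The factor 1 in the exponent matches the pattern \<open>C * exp (k * norm x)\<close> of
  the integrability criterion.\<close>

lemma inner_le_exp_norm: "\<bar>a \<bullet> x\<bar> \<le> norm a * exp (1 * norm (x :: real^'d))"
proof -
  have "norm x \<le> exp (1 * norm x)" using exp_ge_add_one_self[of "norm x"] unfolding mult_1 by linarith
  then show ?thesis
    by (intro order.trans[OF Cauchy_Schwarz_ineq2] mult_left_mono) auto
qed

lemma tilt_le_exp_norm: "tilt S a x \<le> exp (norm a * norm x)"
  using Cauchy_Schwarz_ineq2[of a x] pos_def_matrix_nonneg[OF pd, of a] by (simp add: tilt_def)

lemma gaussian_integrable_inner: "integrable (gaussian S) (\<lambda>x. a \<bullet> x)"
  by (rule gaussian_integrable_exp_bound[OF _ inner_le_exp_norm]) simp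

text \<open>By \<open>2 * u * v \<le> u\<^sup>2 + v\<^sup>2\<close> the product is dominated by the
  sum of two integrable functions.\<close>

lemma L2_gaussian_integrable_exp_norm:
  assumes "f \<in> L2 (gaussian S)"
  shows "integrable (gaussian S) (\<lambda>x. f x * exp (k * norm x))"
proof (rule Bochner_Integration.integrable_bound)
  have [measurable]: "f \<in> borel_measurable borel" and f2: "integrable (gaussian S) (\<lambda>x. (f x)\<^sup>2)"
    using assms by (auto simp: L2_def measurable_gaussian)
  show "integrable (gaussian S) (\<lambda>x. (f x)\<^sup>2 + exp ((2 * k) * norm x))"
    by (intro Bochner_Integration.integrable_add f2 gaussian_integrable_exp_norm)
  show "(\<lambda>x. f x * exp (k * norm x)) \<in> borel_measurable (gaussian S)" by simp
  show "AE x in gaussian S. norm (f x * exp (k * norm x)) \<le> norm ((f x)\<^sup>2 + exp ((2 * k) * norm x))"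
  proof (rule AE_I2)
    fix x
    have "2 * (\<bar>f x\<bar> * exp (k * norm x)) \<le> (f x)\<^sup>2 + (exp (k * norm x))\<^sup>2"
      using sum_squares_bound[of "\<bar>f x\<bar>" "exp (k * norm x)"] by (simp add: mult.assoc)
    moreover have "(exp (k * norm x))\<^sup>2 = exp ((2 * k) * norm x)"
      by (simp add: power2_eq_square flip: exp_add)
    moreover have "0 \<le> \<bar>f x\<bar> * exp (k * norm x)" by simp
    ultimately have "\<bar>f x\<bar> * exp (k * norm x) \<le> (f x)\<^sup>2 + exp ((2 * k) * norm x)" by linarith
    then show "norm (f x * exp (k * norm x)) \<le> norm ((f x)\<^sup>2 + exp ((2 * k) * norm x))"
      by (simp add: abs_mult)
  qed
qed

text \<open>The codomain of \<open>g\<close> is general so as to cover both the real tilts and the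
  vector-valued first moment \<open>f x *\<^sub>R x\<close>.\<close>

lemma L2_gaussian_integrable_dominated:
  fixes g :: "real^'d \<Rightarrow> 'b::{banach, second_countable_topology}"
  assumes "f \<in> L2 (gaussian S)" "g \<in> borel_measurable borel" "\<And>x. norm (g x) \<le> C * exp (k * norm x)"
  shows "integrable (gaussian S) (\<lambda>x. f x *\<^sub>R g x)"
proof (rule Bochner_Integration.integrable_bound[of _ "\<lambda>x. C * (f x * exp (k * norm x))"])
  have [measurable]: "f \<in> borel_measurable borel" using assms(1) by (simp add: L2_def measurable_gaussian)
  note [measurable] = assms(2)
  show "(\<lambda>x. f x *\<^sub>R g x) \<in> borel_measurable (gaussian S)" by simp
  show "AE x in gaussian S. norm (f x *\<^sub>R g x) \<le> norm (C * (f x * exp (k * norm x)))"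
  proof (rule AE_I2)
    fix x
    have "norm (g x) \<le> \<bar>C\<bar> * exp (k * norm x)"
      by (rule order.trans[OF assms(3)]) (intro mult_right_mono, auto)
    from mult_left_mono[OF this, of "\<bar>f x\<bar>"]
    show "norm (f x *\<^sub>R g x) \<le> norm (C * (f x * exp (k * norm x)))" by (simp add: abs_mult mult_ac)
  qed
qed (intro integrable_mult_right L2_gaussian_integrable_exp_norm assms)

lemma L2_gaussian_integrable_tilt:
  assumes "f \<in> L2 (gaussian S)"
  shows "integrable (gaussian S) (\<lambda>x. f x * tilt S a x)"
  using L2_gaussian_integrable_dominated[OF assms borel_measurable_tilt, of S a 1 "norm a"]
    tilt_le_exp_norm tilt_pos[of S a] by (simp add: less_imp_le)

text \<open>The idea is to differentiate at \<open>t = 0\<close>; convexity, \<open>exp (t * u) \<ge> 1 + t * u\<close>,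
  replaces differentiation under the integral sign.\<close>
lemma integral_inner_eq_0_if_tilt_invariant:
  fixes h :: "real^'d \<Rightarrow> real"
  assumes [measurable]: "h \<in> borel_measurable borel" and h: "\<And>x. 0 \<le> h x" "\<And>x. h x \<le> 1"
    and inv: "\<And>t. (\<integral>x. h x * tilt S (t *\<^sub>R c) x \<partial>gaussian S) = (\<integral>x. h x \<partial>gaussian S)"
  shows "(\<integral>x. h x * (c \<bullet> x) \<partial>gaussian S) = 0"
proof -
  define m where "m = (\<integral>x. h x \<partial>gaussian S)"
  define I where "I = (\<integral>x. h x * (c \<bullet> x) \<partial>gaussian S)"
  define q where "q = c \<bullet> (S *v c)"
  have q: "0 \<le> q" using pos_def_matrix_nonneg[OF pd] by (simp add: q_def)
  have m: "0 \<le> m" unfolding m_def using h by (intro Bochner_Integration.integral_nonneg) auto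
  have hi: "integrable (gaussian S) h"
    by (rule gaussian_integrable_exp_bound[of _ 1 0]) (use h in auto)
  have hci: "integrable (gaussian S) (\<lambda>x. h x * (c \<bullet> x))"
  proof (rule gaussian_integrable_exp_bound)
    fix x
    have "\<bar>h x\<bar> * \<bar>c \<bullet> x\<bar> \<le> 1 * (norm c * exp (1 * norm x))"
      using h inner_le_exp_norm by (intro mult_mono) auto
    then show "\<bar>h x * (c \<bullet> x)\<bar> \<le> norm c * exp (1 * norm x)" by (simp add: abs_mult)
  qed simp
  have hti: "integrable (gaussian S) (\<lambda>x. h x * tilt S a x)" for a
  proof (rule gaussian_integrable_exp_bound)
    fix x
    have "\<bar>h x\<bar> * \<bar>tilt S a x\<bar> \<le> 1 * exp (norm a * norm x)"
      using h tilt_le_exp_norm tilt_pos[of S a x] by (intro mult_mono) auto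
    then show "\<bar>h x * tilt S a x\<bar> \<le> 1 * exp (norm a * norm x)" by (simp add: abs_mult)
  qed simp
  have key: "m + t * I \<le> exp (t\<^sup>2 * q / 2) * m" for t
  proof -
    have "m + t * I = (\<integral>x. h x + t * (h x * (c \<bullet> x)) \<partial>gaussian S)"
      using hi hci by (simp add: m_def I_def)
    also have "\<dots> \<le> (\<integral>x. exp (t\<^sup>2 * q / 2) * (h x * tilt S (t *\<^sub>R c) x) \<partial>gaussian S)"
    proof (rule integral_mono)
      fix x
      have "h x * (1 + t * (c \<bullet> x)) \<le> h x * exp (t * (c \<bullet> x))"
        using h exp_ge_add_one_self by (intro mult_left_mono) auto
      also have "exp (t * (c \<bullet> x)) = exp (t\<^sup>2 * q / 2) * tilt S (t *\<^sub>R c) x"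
        by (simp add: tilt_def q_def matrix_vector_mult_scaleR power2_eq_square flip: exp_add)
      finally show "h x + t * (h x * (c \<bullet> x)) \<le> exp (t\<^sup>2 * q / 2) * (h x * tilt S (t *\<^sub>R c) x)"
        by (simp add: algebra_simps)
    qed (use hi hci hti in auto)
    also have "\<dots> = exp (t\<^sup>2 * q / 2) * m" by (simp add: inv m_def)
    finally show ?thesis .
  qed
  \<comment> \<open>By \<open>key\<close> this function of \<open>t\<close> is nonnegative, and it
    is zero at \<open>t = 0\<close>; being minimal there, it has derivative
    \<open>- I = 0\<close>.\<close>
  have "((\<lambda>t. (exp (t\<^sup>2 * q / 2) * m - m - t * I) ) has_real_derivative - I) (at 0)"
    by (auto intro!: derivative_eq_intros)
  moreover have "\<forall>t. \<bar>0 - t\<bar> < 1 \<longrightarrow> exp (0\<^sup>2 * q / 2) * m - m - 0 * I \<le> exp (t\<^sup>2 * q / 2) * m - m - t * I"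
    using key by (simp add: algebra_simps)
  ultimately have "- I = 0" by (rule DERIV_local_min[OF _ zero_less_one])
  then show ?thesis by (simp add: I_def)
qed

lemma gaussian_integral_inner_eq_0: "(\<integral>x. a \<bullet> x \<partial>gaussian S) = 0"
  using integral_inner_eq_0_if_tilt_invariant[of "\<lambda>x. 1" a] integral_tilt[of "\<lambda>x. 1"] by simp

lemma L2_gaussian_inner: "(\<lambda>x. a \<bullet> x) \<in> L2 (gaussian S)"
proof -
  have "integrable (gaussian S) (\<lambda>x. (a \<bullet> x)\<^sup>2)"
  proof (rule gaussian_integrable_exp_bound)
    show "\<bar>(a \<bullet> x)\<^sup>2\<bar> \<le> (norm a)\<^sup>2 * exp (2 * norm x)" for x
      using power_mono[OF inner_le_exp_norm[of a x], of 2] exp_add[of "norm x" "norm x"]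
      by (simp add: power_mult_distrib power2_eq_square mult_ac)
  qed simp
  then show ?thesis by (simp add: L2_def)
qed

text \<open>The density is positive everywhere, so Gaussian null sets are Lebesgue null sets,
  whereas a hyperplane has Lebesgue-null measure and cannot carry almost every point.\<close>

lemma not_AE_gaussian_inner_eq_0:
  assumes "a \<noteq> 0"
  shows "\<not> (AE x in gaussian S. a \<bullet> x = 0)"
proof
  assume "AE x in gaussian S. a \<bullet> x = 0"
  then have "AE x in lborel. a \<bullet> x = 0"
    unfolding gaussian_def by (subst (asm) AE_density) (simp_all add: gauss_density_pos)
  moreover have "AE x in lborel. a \<bullet> x \<noteq> 0"
  proof (rule AE_I')
    have "negligible {x. a \<bullet> x = 0}" using assms by (intro negligible_hyperplane) auto
    then show "{x. a \<bullet> x = 0} \<in> null_sets lborel"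
      by (simp add: negligible_iff_null_sets null_sets_completion_iff)
  qed auto
  ultimately have "AE x in (lborel :: (real^'d) measure). False" by eventually_elim simp
  then have "emeasure (lborel :: (real^'d) measure) UNIV = 0" by (subst (asm) AE_iff_measurable[OF _ refl]) auto
  then show False by simp
qed

text \<open>Taylor expansion of the transform of \<open>f\<close> at the origin: the constant term
  is the mean of \<open>f\<close>, the linear term its first moment. The remainder is measured by
  \<open>a \<bullet> (S *v a)\<close> rather than by \<open>norm a\<close>, since that is the
  quantity which the functional equation contracts.\<close>

lemma L2_gaussian_tilt_first_order:
  assumes f: "f \<in> L2 (gaussian S)" and mean: "(\<integral>x. f x \<partial>gaussian S) = 0"
  shows "\<exists>C. \<forall>a. a \<bullet> (S *v a) \<le> r \<longrightarrow>
    \<bar>(\<integral>x. f x * tilt S a x \<partial>gaussian S) - (\<integral>x. f x *\<^sub>R x \<partial>gaussian S) \<bullet> a\<bar> \<le> C * (a \<bullet> (S *v a))"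
proof -
  obtain c where c: "c > 0" "\<And>x. c * (norm x)\<^sup>2 \<le> x \<bullet> (S *v x)"
    using pos_def_matrix_coercive[OF pd] by blast
  \<comment> \<open>A bound on \<open>norm a\<close> in the region
    \<open>a \<bullet> (S *v a) \<le> r\<close>. The additional 2 in \<open>R + 2\<close> pays for
    \<open>(norm x)\<^sup>2 \<le> exp (2 * norm x)\<close>.\<close>
  define R where "R = sqrt (\<bar>r\<bar> / c)"
  define C where "C = (1 / c + 1) * (\<integral>x. \<bar>f x * exp ((R + 2) * norm x)\<bar> \<partial>gaussian S)"
  have fi: "integrable (gaussian S) f" using L2_gaussian_integrable_exp_norm[OF f, of 0] by simp
  have fx: "integrable (gaussian S) (\<lambda>x. f x *\<^sub>R x)"
  proof (rule L2_gaussian_integrable_dominated[OF f])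
    show "norm x \<le> 1 * exp (1 * norm x)" for x :: "real^'d"
      using exp_ge_add_one_self[of "norm x"] unfolding mult_1 by linarith
  qed simp
  have bound: "\<bar>(\<integral>x. f x * tilt S a x \<partial>gaussian S) - (\<integral>x. f x *\<^sub>R x \<partial>gaussian S) \<bullet> a\<bar> \<le> C * (a \<bullet> (S *v a))"
    if ar: "a \<bullet> (S *v a) \<le> r" for a
  proof -
    define q where "q = a \<bullet> (S *v a)"
    have q: "0 \<le> q" using pos_def_matrix_nonneg[OF pd] by (simp add: q_def)
    have a2: "(norm a)\<^sup>2 \<le> q / c" using c by (simp add: q_def pos_le_divide_eq mult.commute)
    have aR: "norm a \<le> R"
    proof -
      have "q / c \<le> \<bar>r\<bar> / c" using ar c(1) by (intro divide_right_mono) (auto simp: q_def)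
      with a2 have "(norm a)\<^sup>2 \<le> \<bar>r\<bar> / c" by linarith
      then show ?thesis unfolding R_def by (rule real_le_rsqrt)
    qed
    have fxa: "integrable (gaussian S) (\<lambda>x. f x * (a \<bullet> x))"
      using integrable_inner_right[OF fx, of a] by (simp add: inner_commute)
    have pt: "\<bar>f x * tilt S a x - f x - f x * (a \<bullet> x)\<bar> \<le> (1 / c + 1) * q * \<bar>f x * exp ((R + 2) * norm x)\<bar>" for x
    proof -
      define u where "u = a \<bullet> x"
      have u: "\<bar>u\<bar> \<le> norm a * norm x" unfolding u_def by (rule Cauchy_Schwarz_ineq2)
      have uR: "\<bar>u\<bar> \<le> R * norm x" using order.trans[OF u mult_right_mono[OF aR]] by simp
      \<comment> \<open>The first summand is the Taylor remainder in \<open>u\<close>; the second is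
        the effect of the normalizing constant, which is of order \<open>q\<close>.\<close>
      have "\<bar>tilt S a x - 1 - u\<bar> = \<bar>(exp u - 1 - u) + (exp (- (q / 2)) - 1) * exp u\<bar>"
        by (simp add: tilt_def u_def q_def left_diff_distrib flip: exp_add)
      also have "\<dots> \<le> \<bar>exp u - 1 - u\<bar> + \<bar>exp (- (q / 2)) - 1\<bar> * exp u"
        by (rule order.trans[OF abs_triangle_ineq]) (simp add: abs_mult)
      also have "\<dots> \<le> u\<^sup>2 * exp \<bar>u\<bar> + q * exp \<bar>u\<bar>"
      proof (intro add_mono mult_mono exp_minus_one_minus_self_bound)
        show "\<bar>exp (- (q / 2)) - 1\<bar> \<le> q" using q exp_ge_add_one_self[of "- (q / 2)"] by simp
      qed (use q in auto)
      also have "\<dots> = (u\<^sup>2 + q) * exp \<bar>u\<bar>" by (simp add: distrib_right)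
      also have "\<dots> \<le> ((1 / c + 1) * q * exp (2 * norm x)) * exp (R * norm x)"
      proof (intro mult_mono)
        have e2: "exp (2 * norm x) = (exp (norm x))\<^sup>2" by (simp add: power2_eq_square flip: exp_add)
        have "norm x \<le> exp (norm x)" using exp_ge_add_one_self[of "norm x"] by linarith
        then have n2: "(norm x)\<^sup>2 \<le> exp (2 * norm x)" unfolding e2 by (intro power_mono) auto
        have "u\<^sup>2 \<le> (norm a)\<^sup>2 * (norm x)\<^sup>2"
          using power_mono[OF u, of 2] by (simp add: power_mult_distrib)
        also have "\<dots> \<le> q / c * exp (2 * norm x)" using a2 n2 q c(1) by (intro mult_mono) auto
        finally have "u\<^sup>2 \<le> q / c * exp (2 * norm x)" .
        moreover have "q * 1 \<le> q * exp (2 * norm x)" using q by (intro mult_left_mono) auto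
        ultimately show "u\<^sup>2 + q \<le> (1 / c + 1) * q * exp (2 * norm x)"
          by (simp add: algebra_simps)
        show "exp \<bar>u\<bar> \<le> exp (R * norm x)" using uR by simp
        show "0 \<le> (1 / c + 1) * q * exp (2 * norm x)" using q c(1) by simp
      qed simp
      also have "\<dots> = (1 / c + 1) * q * exp ((R + 2) * norm x)"
        by (simp add: mult.assoc distrib_right flip: exp_add) (simp add: add.commute)
      finally have "\<bar>f x\<bar> * \<bar>tilt S a x - 1 - u\<bar> \<le> \<bar>f x\<bar> * ((1 / c + 1) * q * exp ((R + 2) * norm x))"
        by (intro mult_left_mono) auto
      moreover have "\<bar>f x\<bar> * \<bar>tilt S a x - 1 - u\<bar> = \<bar>f x * tilt S a x - f x - f x * (a \<bullet> x)\<bar>"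
        by (simp add: u_def right_diff_distrib flip: abs_mult)
      ultimately show ?thesis by (simp add: abs_mult mult_ac)
    qed
    have "(\<integral>x. f x *\<^sub>R x \<partial>gaussian S) \<bullet> a = (\<integral>x. f x * (a \<bullet> x) \<partial>gaussian S)"
      using integral_inner_left[OF fx, of a] by (simp add: inner_commute)
    then have "(\<integral>x. f x * tilt S a x \<partial>gaussian S) - (\<integral>x. f x *\<^sub>R x \<partial>gaussian S) \<bullet> a
        = (\<integral>x. f x * tilt S a x - f x - f x * (a \<bullet> x) \<partial>gaussian S)"
      using fi fxa L2_gaussian_integrable_tilt[OF f, of a] mean by simp
    also have "\<bar>\<dots>\<bar> \<le> (\<integral>x. \<bar>f x * tilt S a x - f x - f x * (a \<bullet> x)\<bar> \<partial>gaussian S)"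
      by (rule integral_abs_bound)
    also have "\<dots> \<le> (\<integral>x. (1 / c + 1) * q * \<bar>f x * exp ((R + 2) * norm x)\<bar> \<partial>gaussian S)"
      using pt fi fxa L2_gaussian_integrable_tilt[OF f, of a] L2_gaussian_integrable_exp_norm[OF f, of "R + 2"]
      by (intro integral_mono) auto
    finally show ?thesis by (simp add: C_def q_def mult_ac)
  qed
  then show ?thesis by blast
qed

end

section \<open>The block kernels\<close>

lemma drop_block_measurable [measurable]: "drop_block blk i \<in> borel_measurable borel"
proof -
  have "linear (drop_block blk i)"
    by (rule linearI) (auto simp: drop_block_def vec_eq_iff)
  then show ?thesis
    by (intro borel_measurable_continuous_onI linear_continuous_on) (simp add: linear_conv_bounded_linear)
qed

lemma space_other_blocks_algebra [simp]: "space (other_blocks_algebra blk i) = UNIV"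
  by (simp add: other_blocks_algebra_def)

lemma sets_other_blocks_algebra:
  "sets (other_blocks_algebra blk i) = {drop_block blk i -` A | A. A \<in> sets borel}"
  by (simp add: other_blocks_algebra_def sets_vimage_algebra2)

lemma subalgebra_other_blocks_algebra: "subalgebra (gaussian S) (other_blocks_algebra blk i)"
  unfolding subalgebra_def
proof (intro conjI subsetI)
  fix X assume "X \<in> sets (other_blocks_algebra blk i)"
  then obtain A where "A \<in> sets borel" "X = drop_block blk i -` A"
    unfolding sets_other_blocks_algebra by blast
  then show "X \<in> sets (gaussian S)"
    using measurable_sets[OF drop_block_measurable, of A blk i] by simp
qed simp

text \<open>The matrix \<open>mat 1\<close> in the proof is an arbitrary choice, as the
  sigma-algebras involved do not depend on the covariance.\<close>

lemma other_blocks_measurable_imp_borel: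
  fixes h :: "real^'d \<Rightarrow> real"
  assumes "h \<in> borel_measurable (other_blocks_algebra blk i)"
  shows "h \<in> borel_measurable borel"
  using measurable_from_subalg[OF subalgebra_other_blocks_algebra[of "mat 1"] assms]
  unfolding measurable_gaussian .

text \<open>The level set of \<open>h\<close> through \<open>x\<close> is a preimage under
  \<open>drop_block blk i\<close>, so it cannot separate points with the same image. The equality
  holds pointwise, not just almost everywhere.\<close>

lemma other_blocks_measurable_cong:
  fixes h :: "real^'d \<Rightarrow> real"
  assumes "h \<in> borel_measurable (other_blocks_algebra blk i)" "drop_block blk i x = drop_block blk i y"
  shows "h x = h y"
proof -
  have "h -` {h x} \<in> sets (other_blocks_algebra blk i)"
    using measurable_sets[OF assms(1), of "{h x}"] by simp
  then obtain A where A: "h -` {h x} = drop_block blk i -` A"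
    by (auto simp: sets_other_blocks_algebra)
  have "x \<in> h -` {h x}" by simp
  then have "y \<in> h -` {h x}" using assms(2) unfolding A by simp
  then show ?thesis by simp
qed

lemma other_blocks_measurable_inner:
  fixes a :: "real^'d"
  assumes "\<And>j. blk j = i \<Longrightarrow> a $ j = 0"
  shows "(\<lambda>x. a \<bullet> x) \<in> borel_measurable (other_blocks_algebra blk i)"
proof -
  have eq: "a \<bullet> x = a \<bullet> drop_block blk i x" for x
    unfolding inner_vec_def by (intro sum.cong refl) (auto simp: drop_block_def assms)
  have [measurable]: "drop_block blk i \<in> measurable (other_blocks_algebra blk i) borel"
    unfolding other_blocks_algebra_def by (rule measurable_vimage_algebra1) simp
  show ?thesis by (rule measurable_cong[THEN iffD2, OF eq]) measurable
qed

context
  fixes S :: "real^'d^'d" and blk :: "'d \<Rightarrow> nat" and i :: nat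
  assumes pd: "pos_def_matrix S"
begin

interpretation finite_measure_subalgebra "gaussian S" "other_blocks_algebra blk i"
  by (intro finite_measure_subalgebra.intro finite_measure_gaussian[OF pd]
      finite_measure_subalgebra_axioms.intro subalgebra_other_blocks_algebra)

text \<open>Tilting amounts to a shift, and the shifts by \<open>S *v a\<close> and
  \<open>S *v b\<close> differ only inside block \<open>i\<close>, which \<open>h\<close> does not
  see. This takes the place of an explicit formula for the conditional distribution.\<close>

lemma
  fixes h :: "real^'d \<Rightarrow> real"
  assumes h: "h \<in> borel_measurable (other_blocks_algebra blk i)"
    and ab: "\<And>j. blk j \<noteq> i \<Longrightarrow> (S *v (a - b)) $ j = 0"
  shows integral_tilt_other_blocks:
      "(\<integral>x. h x * tilt S a x \<partial>gaussian S) = (\<integral>x. h x * tilt S b x \<partial>gaussian S)"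
    and integrable_tilt_other_blocks:
      "integrable (gaussian S) (\<lambda>x. h x * tilt S a x) \<longleftrightarrow> integrable (gaussian S) (\<lambda>x. h x * tilt S b x)"
proof -
  have "drop_block blk i (x + S *v a) = drop_block blk i (x + S *v b)" for x
    using ab by (auto simp: drop_block_def vec_eq_iff matrix_vector_mult_diff_distrib)
  then have "h (x + S *v a) = h (x + S *v b)" for x
    by (rule other_blocks_measurable_cong[OF h])
  moreover note hb = other_blocks_measurable_imp_borel[OF h]
  ultimately show "(\<integral>x. h x * tilt S a x \<partial>gaussian S) = (\<integral>x. h x * tilt S b x \<partial>gaussian S)"
    "integrable (gaussian S) (\<lambda>x. h x * tilt S a x) \<longleftrightarrow> integrable (gaussian S) (\<lambda>x. h x * tilt S b x)"
    by (simp_all add: integral_tilt[OF pd hb] integrable_tilt_iff[OF pd hb])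
qed

lemma tilt_block_proj_measurable:
  "tilt S (block_proj S blk i a) \<in> borel_measurable (other_blocks_algebra blk i)"
proof -
  have [measurable]: "(\<lambda>x. block_proj S blk i a \<bullet> x) \<in> borel_measurable (other_blocks_algebra blk i)"
    by (rule other_blocks_measurable_inner) (rule block_proj_in_block[OF pd])
  show ?thesis unfolding tilt_def by measurable
qed

text \<open>The conditional expectation depends only on the other blocks, so \<open>a\<close> may be
  replaced by its projection, the residual shift being confined to block \<open>i\<close>. The
  projected tilt is itself measurable for the other blocks, hence conditioning can be removed under
  the integral.\<close>

lemma
  assumes f: "f \<in> L2 (gaussian S)"
  shows block_kernel_integrable_tilt:
      "integrable (gaussian S) (\<lambda>x. block_kernel (gaussian S) blk i f x * tilt S a x)"
    and block_kernel_integral_tilt: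
      "(\<integral>x. block_kernel (gaussian S) blk i f x * tilt S a x \<partial>gaussian S) =
       (\<integral>x. f x * tilt S (block_proj S blk i a) x \<partial>gaussian S)"
proof -
  define P where "P = block_proj S blk i a"
  define g where "g = block_kernel (gaussian S) blk i f"
  have g: "g \<in> borel_measurable (other_blocks_algebra blk i)"
    unfolding g_def block_kernel_def by (rule borel_measurable_cond_exp)
  have fm: "f \<in> borel_measurable (gaussian S)" using f by (simp add: L2_def)
  have "integrable (gaussian S) (\<lambda>x. tilt S P x * f x)"
    using L2_gaussian_integrable_tilt[OF pd f] by (simp add: mult.commute)
  from real_cond_exp_intg[OF this tilt_block_proj_measurable[of a, folded P_def] fm]
  have P: "integrable (gaussian S) (\<lambda>x. g x * tilt S P x)"
    "(\<integral>x. g x * tilt S P x \<partial>gaussian S) = (\<integral>x. f x * tilt S P x \<partial>gaussian S)"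
    by (simp_all add: g_def block_kernel_def mult.commute)
  have res: "(S *v (a - P)) $ j = 0" if "blk j \<noteq> i" for j
    unfolding P_def using that by (rule block_proj_residual[OF pd])
  show "integrable (gaussian S) (\<lambda>x. block_kernel (gaussian S) blk i f x * tilt S a x)"
    using P(1) integrable_tilt_other_blocks[OF g res] by (simp add: g_def)
  show "(\<integral>x. block_kernel (gaussian S) blk i f x * tilt S a x \<partial>gaussian S) =
       (\<integral>x. f x * tilt S (block_proj S blk i a) x \<partial>gaussian S)"
    using P(2) integral_tilt_other_blocks[OF g res] by (simp add: g_def P_def)
qed

text \<open>Tilting by multiples of the residual \<open>c\<close> moves only block \<open>i\<close>,
  so it leaves the integral of \<open>indicator A\<close> unchanged. Differentiating in the multiple
  shows that \<open>c \<bullet> x\<close> integrates to zero over \<open>A\<close>, which is the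
  defining property of the conditional expectation.\<close>

lemma block_kernel_inner:
  "AE x in gaussian S. block_kernel (gaussian S) blk i (\<lambda>x. a \<bullet> x) x = block_proj S blk i a \<bullet> x"
  unfolding block_kernel_def
proof (rule real_cond_exp_charact)
  fix A assume A: "A \<in> sets (other_blocks_algebra blk i)"
  define c where "c = a - block_proj S blk i a"
  have h: "(indicator A :: _ \<Rightarrow> real) \<in> borel_measurable (other_blocks_algebra blk i)" using A by simp
  have [measurable]: "A \<in> sets borel"
    using A subalgebra_other_blocks_algebra[of S blk i] by (auto simp: subalgebra_def)
  have "(\<integral>x. indicator A x * tilt S (t *\<^sub>R c) x \<partial>gaussian S) = (\<integral>x. indicator A x * tilt S 0 x \<partial>gaussian S)" for t
  proof (rule integral_tilt_other_blocks[OF h])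
    fix j assume "blk j \<noteq> i"
    then show "(S *v (t *\<^sub>R c - 0)) $ j = 0"
      using block_proj_residual[OF pd, of blk j i a] by (simp add: c_def matrix_vector_mult_scaleR)
  qed
  then have "(\<integral>x. indicator A x * (c \<bullet> x) \<partial>gaussian S) = 0"
    by (intro integral_inner_eq_0_if_tilt_invariant[OF pd]) auto
  moreover have i: "integrable (gaussian S) (\<lambda>x. indicator A x * (b \<bullet> x))" for b
    using integrable_mult_indicator[OF _ gaussian_integrable_inner[OF pd], of A b] by simp
  moreover have "(\<integral>x. indicator A x * (c \<bullet> x) \<partial>gaussian S) =
      (\<integral>x. indicator A x * (a \<bullet> x) - indicator A x * (block_proj S blk i a \<bullet> x) \<partial>gaussian S)"
    by (simp add: c_def inner_diff_left right_diff_distrib)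
  ultimately show "(LINT x:A|gaussian S. a \<bullet> x) = (LINT x:A|gaussian S. block_proj S blk i a \<bullet> x)"
    by (simp add: set_lebesgue_integral_def)
next
  show "(\<lambda>x. block_proj S blk i a \<bullet> x) \<in> borel_measurable (other_blocks_algebra blk i)"
    by (rule other_blocks_measurable_inner) (rule block_proj_in_block[OF pd])
qed (rule gaussian_integrable_inner[OF pd])+

end

section \<open>The second eigenvalue of the random scan kernel\<close>

theorem theorem2:
  fixes S :: "real^'d^'d" and blk :: "'d \<Rightarrow> nat" and s :: nat and p :: "nat \<Rightarrow> real"
  assumes "pos_def_matrix S"
    and "blk ` UNIV = {..<s}"
    and "\<forall>i<s. p i > 0"
    and "(\<Sum>i<s. p i) = 1"
  shows "\<exists>a :: real^'d. a \<noteq> 0 \<and>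
           is_eigenpair (gaussian S) (rsgs (gaussian S) blk s p)
             (second_eigenvalue (gaussian S) (rsgs (gaussian S) blk s p)) (\<lambda>x. a \<bullet> x)"
proof -
  note pd = assms(1)
  have p: "0 \<le> p i" if "i < s" for i using assms(3) that by (simp add: less_imp_le)
  define Q where "Q = block_proj S blk"
  have Qlin: "linear (Q i)" for i unfolding Q_def by (rule block_proj_linear[OF pd])
  have Qsym: "b \<bullet> (S *v Q i a) = Q i b \<bullet> (S *v Q i a)" for i a b
    unfolding Q_def by (rule block_proj_sym[OF pd])
  define K where "K a = (\<Sum>i<s. p i *\<^sub>R Q i a)" for a
  have SK: "b \<bullet> (S *v K a) = (\<Sum>i<s. p i * (Q i b \<bullet> (S *v Q i a)))" for a b
  proof -
    have "b \<bullet> (S *v K a) = (\<Sum>i<s. p i * (b \<bullet> (S *v Q i a)))"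
      by (simp add: K_def inner_sum_right linear_sum[OF matrix_vector_mul_linear] matrix_vector_mult_scaleR)
    then show ?thesis unfolding Qsym[of b] .
  qed
  have "linear K"
    unfolding K_def by (intro linear_compose_sum ballI linear_compose_scale_right Qlin)
  moreover have "a \<bullet> (S *v K b) = b \<bullet> (S *v K a)" for a b
    unfolding SK by (intro sum.cong refl) (metis pos_def_matrix_sym[OF pd])
  ultimately obtain l a where a: "a \<noteq> 0" "K a = l *\<^sub>R a"
    and rayleigh: "\<And>b. b \<bullet> (S *v K b) \<le> l * (b \<bullet> (S *v b))"
    using max_rayleigh_eigenvector[OF pd] by blast
  \<comment> \<open>The form of \<open>K\<close> is a nonnegative combination of squares, so
    \<open>l\<close> is nonnegative and the ratio \<open>l / \<mu>\<close> of the iteration lies in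
    \<open>[0, 1)\<close>.\<close>
  have "0 \<le> l * (a \<bullet> (S *v a))"
  proof -
    have "0 \<le> a \<bullet> (S *v K a)"
      unfolding SK using p pos_def_matrix_nonneg[OF pd] by (intro sum_nonneg mult_nonneg_nonneg) auto
    then show ?thesis by (simp add: a(2) matrix_vector_mult_scaleR)
  qed
  moreover have "0 < a \<bullet> (S *v a)" using pd a(1) by (simp add: pos_def_matrix_def)
  ultimately have l0: "0 \<le> l" by (simp add: zero_le_mult_iff)
  let ?T = "rsgs (gaussian S) blk s p"
  have eigen: "is_eigenpair (gaussian S) ?T l (\<lambda>x. a \<bullet> x)"
    unfolding is_eigenpair_def
  proof (intro conjI L2_gaussian_inner[OF pd] not_AE_gaussian_inner_eq_0[OF pd a(1)])
    have "AE x in gaussian S. \<forall>i\<in>{..<s}. block_kernel (gaussian S) blk i (\<lambda>x. a \<bullet> x) x = Q i a \<bullet> x"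
      unfolding Q_def by (intro AE_finite_allI block_kernel_inner[OF pd]) simp
    then show "AE x in gaussian S. ?T (\<lambda>x. a \<bullet> x) x = l * (a \<bullet> x)"
    proof eventually_elim
      case (elim x)
      then have "?T (\<lambda>x. a \<bullet> x) x = (\<Sum>i<s. p i * (Q i a \<bullet> x))"
        by (simp add: rsgs_def)
      also have "\<dots> = K a \<bullet> x" by (simp add: K_def inner_sum_left)
      finally show ?case by (simp add: a(2))
    qed
  qed
  \<comment> \<open>A larger eigenvalue would force the transform of its mean-zero eigenfunction to
    vanish identically, and with it the eigenfunction.\<close>
  have upper: "\<mu> \<le> l" if f: "is_eigenpair (gaussian S) ?T \<mu> f" and mean: "integral\<^sup>L (gaussian S) f = 0" for \<mu> f
  proof (rule ccontr)
    assume "\<not> \<mu> \<le> l"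
    then have \<mu>: "l < \<mu>" by simp
    have fL2: "f \<in> L2 (gaussian S)" and fne: "\<not> (AE x in gaussian S. f x = 0)"
      and ff: "AE x in gaussian S. ?T f x = \<mu> * f x"
      using f by (auto simp: is_eigenpair_def)
    define F where "F a = (\<integral>x. f x * tilt S a x \<partial>gaussian S)" for a
    have F0: "F b = 0" for b
    proof (rule functional_equation_imp_zero[OF pd p Qlin Qsym, where l = l and \<mu> = \<mu>])
      show "\<mu> * F b = (\<Sum>i<s. p i * F (Q i b))" for b
      proof -
        have "\<mu> * F b = (\<integral>x. (\<mu> * f x) * tilt S b x \<partial>gaussian S)" by (simp add: F_def mult.assoc)
        also have "\<dots> = (\<integral>x. ?T f x * tilt S b x \<partial>gaussian S)"
        proof (rule integral_cong_AE)
          have [measurable]: "f \<in> borel_measurable borel" using fL2 by (simp add: L2_def measurable_gaussian)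
          have [measurable]: "block_kernel (gaussian S) blk i f \<in> borel_measurable borel" for i
            unfolding block_kernel_def by (rule other_blocks_measurable_imp_borel) (rule borel_measurable_cond_exp)
          show "(\<lambda>x. (\<mu> * f x) * tilt S b x) \<in> borel_measurable (gaussian S)" by simp
          show "(\<lambda>x. ?T f x * tilt S b x) \<in> borel_measurable (gaussian S)" unfolding rsgs_def by simp
          show "AE x in gaussian S. (\<mu> * f x) * tilt S b x = ?T f x * tilt S b x"
            using ff by eventually_elim simp
        qed
        also have "\<dots> = (\<integral>x. (\<Sum>i<s. p i * (block_kernel (gaussian S) blk i f x * tilt S b x)) \<partial>gaussian S)"
          by (simp add: rsgs_def sum_distrib_right mult.assoc)
        also have "\<dots> = (\<Sum>i<s. p i * F (Q i b))"
          using block_kernel_integrable_tilt[OF pd fL2]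
          by (simp add: F_def Q_def block_kernel_integral_tilt[OF pd fL2])
        finally show ?thesis .
      qed
      show "\<exists>C. \<forall>a. a \<bullet> (S *v a) \<le> r \<longrightarrow>
          \<bar>F a - (\<integral>x. f x *\<^sub>R x \<partial>gaussian S) \<bullet> a\<bar> \<le> C * (a \<bullet> (S *v a))" for r
        unfolding F_def by (rule L2_gaussian_tilt_first_order[OF pd fL2 mean])
      show "Q i a \<bullet> (S *v Q i a) \<le> a \<bullet> (S *v a)" for i a
        unfolding Q_def by (rule block_proj_contraction[OF pd])
      show "(\<Sum>i<s. p i * (Q i a \<bullet> (S *v Q i a))) \<le> l * (a \<bullet> (S *v a))" for a
        using rayleigh[of a] by (simp add: SK)
    qed (use l0 \<mu> in auto)
    have "AE x in gaussian S. f x = 0"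
    proof (rule laplace_transform_eq_0_imp_AE_eq_0)
      fix b
      have "(\<integral>x. f x * exp (b \<bullet> x) \<partial>gaussian S) = (\<integral>x. exp (b \<bullet> (S *v b) / 2) * (f x * tilt S b x) \<partial>gaussian S)"
        by (intro Bochner_Integration.integral_cong) (simp_all add: tilt_def exp_diff)
      also have "\<dots> = 0" using F0[of b] by (simp add: F_def)
      finally show "(\<integral>x. f x * exp (b \<bullet> x) \<partial>gaussian S) = 0" .
    qed (use fL2 L2_gaussian_integrable_exp_norm[OF pd fL2] in \<open>auto simp: L2_def\<close>)
    with fne show False ..
  qed
  \<comment> \<open>The value \<open>l\<close> is attained by the mean-zero function
    \<open>a \<bullet> x\<close>, so the supremum is a maximum.\<close>
  have "second_eigenvalue (gaussian S) ?T = l"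
    unfolding second_eigenvalue_def
  proof (rule cSup_eq_maximum)
    show "l \<in> {\<mu>. \<exists>f. is_eigenpair (gaussian S) ?T \<mu> f \<and> integral\<^sup>L (gaussian S) f = 0}"
      using eigen gaussian_integral_inner_eq_0[OF pd] by blast
  qed (use upper in blast)
  with a(1) eigen show ?thesis by blast
qed

end
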